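(* Let the operators $A$, $\Sigma_0$, the truth $u^\dagger$ and the initial mean $m_0$ satisfy Assumption A (in the context), and let $m_n$ be the Kalman filter mean computed from Data Model 1 with initial covariance $C_0=\frac{\gamma^2}{\alpha}\Sigma_0$. Then there is a constant $C$, independent of $n$, $\gamma$ and $\alpha$, such that for all $n\ge 1$ $$\mathbb{E}\|m_n-u^\dagger\|^2\le C\left(\frac{\alpha}{n}\right)^{\frac{s}{a+1}}+\frac{\gamma^2}{\alpha}\,\mathrm{tr}(\Sigma_0).$$ Moreover, for every integer $N\ge 1$, if one sets $\alpha=N^{\frac{s}{s+a+1}}$ and stops the iteration at $n=N$, then $$\mathbb{E}\|m_N-u^\dagger\|^2\le\left(C+\gamma^2\,\mathrm{tr}(\Sigma_0)\right)N^{-\frac{s}{s+a+1}}.$$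
   Context: $X,Y$ are Hilbert spaces, $A$ is a compact linear operator from $X$ to $Y$, $u^\dagger\in X$ is a fixed (deterministic) element, $\gamma>0$, $\alpha>0$. $\|\cdot\|$ denotes the norm of $X$ (also of $Y$ and operator norms), $\mathcal{R}$ and $\mathcal{D}$ denote range and domain. $\mathcal{N}(0,\gamma^2 I)$ is the centred Gaussian on $Y$ with covariance $\gamma^2 I$ (Gaussian white noise if $Y$ is infinite dimensional, so that $\mathbb{E}\|F\eta\|^2=\gamma^2\,\mathrm{tr}(FF^* )$ for $\eta\sim\mathcal{N}(0,\gamma^2I)$ and a bounded linear $F:Y\to X$). Data Model 1: $y_n=Au^\dagger+\eta_n$, $n\ge1$, with $\eta_n$ i.i.d. $\mathcal{N}(0,\gamma^2I)$. Kalman filter: given $m_0\in X$ and $C_0$, for $n\ge 1$ $$K_n=C_{n-1}A^*(AC_{n-1}A^*+\gamma^2I)^{-1},\quad m_n=m_{n-1}+K_n(y_n-Am_{n-1}),\quad C_n=(I-K_nA)C_{n-1}.$$ Assumption A: (i) $C_0=\frac{\gamma^2}{\alpha}\Sigma_0$ and $\mathcal{R}(\Sigma_0^{1/2})\subset\mathcal{D}(A)$, where $\alpha>0$ is a constant, $\Sigma_0$ is positive self-adjoint on $X$, and $\Sigma_0^{-1}$ is a densely defined unbounded self-adjoint strictly positive operator; (ii) there are constants $a>0$ and $1\le c<\infty$ with $c^{-1}\|\Sigma_0^{a/2}x\|\le\|Ax\|\le c\|\Sigma_0^{a/2}x\|$ for all $x\in X$; (iii) $m_0-u^\dagger\in\mathcal{D}(\Sigma_0^{-s/2})$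 with $0\le s\le a+2$; (iv) $\Sigma_0$ is trace class on $X$. *)

theory Defs
  imports "HOL-Probability.Probability"
begin

definition compact_operator :: "('x::real_normed_vector \<Rightarrow> 'y::real_normed_vector) \<Rightarrow> bool" where
  "compact_operator A \<longleftrightarrow> bounded_linear A \<and> compact (closure (A ` cball 0 1))"

definition positive_selfadjoint :: "('x::real_inner \<Rightarrow> 'x) \<Rightarrow> bool" where
  "positive_selfadjoint S \<longleftrightarrow>
     bounded_linear S \<and> (\<forall>x y. S x \<bullet> y = x \<bullet> S y) \<and> (\<forall>x. 0 \<le> S x \<bullet> x)"

text \<open>
  A possibly unbounded operator is a pair of a domain \<open>D\<close> and a function \<open>T\<close> whose values
  outside \<open>D\<close> are irrelevant.  Self-adjointness means that \<open>T\<close> is densely defined and symmetric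
  and that the domain of its adjoint, which is the set in the last conjunct, equals \<open>D\<close>.
\<close>

definition densely_defined_linear :: "'x::real_inner set \<Rightarrow> ('x \<Rightarrow> 'x) \<Rightarrow> bool" where
  "densely_defined_linear D T \<longleftrightarrow>
     subspace D \<and> closure D = UNIV \<and>
     (\<forall>x\<in>D. \<forall>y\<in>D. T (x + y) = T x + T y) \<and> (\<forall>r. \<forall>x\<in>D. T (r *\<^sub>R x) = r *\<^sub>R T x)"

definition selfadjoint_on :: "'x::real_inner set \<Rightarrow> ('x \<Rightarrow> 'x) \<Rightarrow> bool" where
  "selfadjoint_on D T \<longleftrightarrow>
     densely_defined_linear D T \<and>
     (\<forall>x\<in>D. \<forall>y\<in>D. T x \<bullet> y = x \<bullet> T y) \<and>
     {y. \<exists>z. \<forall>x\<in>D. T x \<bullet> y = x \<bullet> z} = D"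

definition strictly_positive_on :: "'x::real_inner set \<Rightarrow> ('x \<Rightarrow> 'x) \<Rightarrow> bool" where
  "strictly_positive_on D T \<longleftrightarrow> (\<exists>\<theta>>0. \<forall>x\<in>D. \<theta> * (norm x)\<^sup>2 \<le> T x \<bullet> x)"

definition orthonormal_basis :: "'x::real_inner set \<Rightarrow> bool" where
  "orthonormal_basis B \<longleftrightarrow>
     pairwise orthogonal B \<and> (\<forall>e\<in>B. norm e = 1) \<and> closure (span B) = UNIV"

text \<open>
  For a positive operator neither the existence nor the value of the trace depends on the
  choice of the orthonormal basis.
\<close>

definition positive_trace_class :: "('x::real_inner \<Rightarrow> 'x) \<Rightarrow> bool" where
  "positive_trace_class S \<longleftrightarrow>
     positive_selfadjoint S \<and> (\<exists>B. orthonormal_basis B \<and> (\<lambda>e. S e \<bullet> e) summable_on B)"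

definition op_trace :: "('x::real_inner \<Rightarrow> 'x) \<Rightarrow> real" where
  "op_trace S = (\<Sum>\<^sub>\<infinity>e\<in>(SOME B. orthonormal_basis B). S e \<bullet> e)"

text \<open>
  Powers of an injective, positive, self-adjoint, diagonalizable operator (such as an injective
  positive trace class operator) for arbitrary real exponents, by the spectral calculus
  \<open>S^t x = (\<Sum>e. \<lambda>\<^sub>e^t \<langle>x, e\<rangle> e)\<close>, where \<open>e\<close> runs through an orthonormal basis of eigenvectors
  and \<open>\<lambda>\<^sub>e = \<langle>S e, e\<rangle>\<close> is the eigenvalue of \<open>e\<close>.  The domain is the set of all \<open>x\<close> for which
  the series converges, the whole space if \<open>t \<ge> 0\<close>.
\<close>

definition eigenbasis :: "('x::real_inner \<Rightarrow> 'x) \<Rightarrow> 'x set \<Rightarrow> bool" where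
  "eigenbasis S B \<longleftrightarrow> orthonormal_basis B \<and> (\<forall>e\<in>B. \<exists>l. S e = l *\<^sub>R e)"

definition op_powr_term :: "('x::real_inner \<Rightarrow> 'x) \<Rightarrow> real \<Rightarrow> 'x \<Rightarrow> 'x \<Rightarrow> 'x" where
  "op_powr_term S t x e = ((S e \<bullet> e) powr t * (x \<bullet> e)) *\<^sub>R e"

definition op_powr :: "('x::real_inner \<Rightarrow> 'x) \<Rightarrow> real \<Rightarrow> 'x \<Rightarrow> 'x" where
  "op_powr S t x = (\<Sum>\<^sub>\<infinity>e\<in>(SOME B. eigenbasis S B). op_powr_term S t x e)"

definition op_powr_domain :: "('x::real_inner \<Rightarrow> 'x) \<Rightarrow> real \<Rightarrow> 'x set" where
  "op_powr_domain S t = {x. op_powr_term S t x summable_on (SOME B. eigenbasis S B)}"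

text \<open>
  The forward operator \<open>A\<close> is defined on the whole space, so the range of the square root
  of \<open>S\<close> is automatically contained in the domain of \<open>A\<close>.  The inverse of \<open>S\<close> has the
  domain \<open>range S\<close>; ``unbounded'' is read as ``not necessarily bounded''.
\<close>

definition assumption_A ::
    "('x::{real_inner,banach} \<Rightarrow> 'y::{real_inner,banach}) \<Rightarrow> ('x \<Rightarrow> 'x) \<Rightarrow> 'x \<Rightarrow> 'x \<Rightarrow>
     real \<Rightarrow> real \<Rightarrow> real \<Rightarrow> bool" where
  "assumption_A A S u m\<^sub>0 a c s \<longleftrightarrow>
     positive_selfadjoint S \<and> inj S \<and>
     selfadjoint_on (range S) (inv S) \<and> strictly_positive_on (range S) (inv S) \<and>
     0 < a \<and> 1 \<le> c \<and>
     (\<forall>x. inverse c * norm (op_powr S (a / 2) x) \<le> norm (A x) \<and>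
          norm (A x) \<le> c * norm (op_powr S (a / 2) x)) \<and>
     0 \<le> s \<and> s \<le> a + 2 \<and> m\<^sub>0 - u \<in> op_powr_domain S (- s / 2) \<and>
     positive_trace_class S"

text \<open>
  Gaussian white noise on an infinite-dimensional Hilbert space \<open>'y\<close> is not an \<open>'y\<close>-valued random
  variable.  A generalized random element of \<open>'y\<close> is therefore represented by the family
  \<open>\<zeta> h\<close> of real random variables that plays the role of \<open>\<langle>\<zeta>, h\<rangle>\<close>.  Linearity and the
  one-dimensional marginals imply that the family is jointly Gaussian, centred, with covariance
  \<open>E[\<zeta> h * \<zeta> k] = \<gamma>\<^sup>2 * (h \<bullet> k)\<close>; the case \<open>h = 0\<close> is covered by linearity.
\<close>

definition gaussian_white_noise ::
    "'w measure \<Rightarrow> real \<Rightarrow> ('y::real_inner \<Rightarrow> 'w \<Rightarrow> real) \<Rightarrow> bool" where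
  "gaussian_white_noise M \<gamma> \<zeta> \<longleftrightarrow>
     (\<forall>h. \<zeta> h \<in> borel_measurable M) \<and>
     (\<forall>p q h k. AE \<omega> in M. \<zeta> (p *\<^sub>R h + q *\<^sub>R k) \<omega> = p * \<zeta> h \<omega> + q * \<zeta> k \<omega>) \<and>
     (\<forall>h. h \<noteq> 0 \<longrightarrow> distributed M lborel (\<zeta> h) (normal_density 0 (\<gamma> * norm h)))"

definition iid_white_noise ::
    "'w measure \<Rightarrow> real \<Rightarrow> (nat \<Rightarrow> 'y::real_inner \<Rightarrow> 'w \<Rightarrow> real) \<Rightarrow> bool" where
  "iid_white_noise M \<gamma> \<eta> \<longleftrightarrow>
     (\<forall>n\<ge>1. gaussian_white_noise M \<gamma> (\<eta> n)) \<and>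
     prob_space.indep_vars M (\<lambda>_. PiM UNIV (\<lambda>_. borel)) (\<lambda>n \<omega> h. \<eta> n h \<omega>) {1..}"

definition data_model_1 ::
    "'w measure \<Rightarrow> ('x \<Rightarrow> 'y::real_inner) \<Rightarrow> 'x \<Rightarrow> real \<Rightarrow> (nat \<Rightarrow> 'y \<Rightarrow> 'w \<Rightarrow> real) \<Rightarrow> bool" where
  "data_model_1 M A u \<gamma> y \<longleftrightarrow>
     prob_space M \<and>
     (\<exists>\<eta>. iid_white_noise M \<gamma> \<eta> \<and> (\<forall>n\<ge>1. \<forall>h \<omega>. y n h \<omega> = A u \<bullet> h + \<eta> n h \<omega>))"

text \<open>
  \<open>Z\<close> is the image \<open>F \<zeta>\<close> of the generalized random element \<open>\<zeta>\<close> under the operator \<open>F\<close>, that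
  is, \<open>\<langle>Z, x\<rangle> = \<langle>\<zeta>, F* x\<rangle>\<close>.  On a separable space this determines \<open>Z\<close> almost surely.
\<close>

definition is_image ::
    "'w measure \<Rightarrow> ('y::real_inner \<Rightarrow> 'x::real_inner) \<Rightarrow> ('y \<Rightarrow> 'w \<Rightarrow> real) \<Rightarrow> ('w \<Rightarrow> 'x) \<Rightarrow> bool" where
  "is_image M F \<zeta> Z \<longleftrightarrow> (\<forall>x. AE \<omega> in M. Z \<omega> \<bullet> x = \<zeta> (adjoint F x) \<omega>)"

definition kalman_gain ::
    "('x::real_inner \<Rightarrow> 'y::real_inner) \<Rightarrow> real \<Rightarrow> ('x \<Rightarrow> 'x) \<Rightarrow> 'y \<Rightarrow> 'x" where
  "kalman_gain A \<gamma> C = C \<circ> adjoint A \<circ> inv (\<lambda>h. A (C (adjoint A h)) + \<gamma>\<^sup>2 *\<^sub>R h)"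

fun kalman_cov ::
    "('x::real_inner \<Rightarrow> 'y::real_inner) \<Rightarrow> real \<Rightarrow> ('x \<Rightarrow> 'x) \<Rightarrow> nat \<Rightarrow> 'x \<Rightarrow> 'x" where
  "kalman_cov A \<gamma> C\<^sub>0 0 = C\<^sub>0"
| "kalman_cov A \<gamma> C\<^sub>0 (Suc n) =
     (\<lambda>x. kalman_cov A \<gamma> C\<^sub>0 n x
            - kalman_gain A \<gamma> (kalman_cov A \<gamma> C\<^sub>0 n) (A (kalman_cov A \<gamma> C\<^sub>0 n x)))"

text \<open>
  The update \<open>m\<^sub>n - m\<^sub>n\<^sub>-\<^sub>1 = K\<^sub>n (y\<^sub>n - A m\<^sub>n\<^sub>-\<^sub>1)\<close>, where the innovation \<open>y\<^sub>n - A m\<^sub>n\<^sub>-\<^sub>1\<close> is a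
  generalized random element of \<open>'y\<close>, whereas the means are genuine \<open>'x\<close>-valued random variables.
\<close>

definition kalman_mean ::
    "'w measure \<Rightarrow> ('x::real_inner \<Rightarrow> 'y::real_inner) \<Rightarrow> real \<Rightarrow> ('x \<Rightarrow> 'x) \<Rightarrow> 'x \<Rightarrow>
     (nat \<Rightarrow> 'y \<Rightarrow> 'w \<Rightarrow> real) \<Rightarrow> (nat \<Rightarrow> 'w \<Rightarrow> 'x) \<Rightarrow> bool" where
  "kalman_mean M A \<gamma> C\<^sub>0 m\<^sub>0 y m \<longleftrightarrow>
     (\<forall>n. m n \<in> borel_measurable M) \<and>
     (\<forall>\<omega>\<in>space M. m 0 \<omega> = m\<^sub>0) \<and>
     (\<forall>n\<ge>1. is_image M (kalman_gain A \<gamma> (kalman_cov A \<gamma> C\<^sub>0 (n - 1)))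
              (\<lambda>h \<omega>. y n h \<omega> - A (m (n - 1) \<omega>) \<bullet> h)
              (\<lambda>\<omega>. m n \<omega> - m (n - 1) \<omega>))"

text \<open>
  The Bochner integral of a non-integrable function is 0, so a bound on an expectation has to
  include integrability.
\<close>

definition mean_square_le :: "'w measure \<Rightarrow> ('w \<Rightarrow> 'x::real_normed_vector) \<Rightarrow> real \<Rightarrow> bool" where
  "mean_square_le M Z b \<longleftrightarrow>
     integrable M (\<lambda>\<omega>. (norm (Z \<omega>))\<^sup>2) \<and> (\<integral>\<omega>. (norm (Z \<omega>))\<^sup>2 \<partial>M) \<le> b"

end

theory Submission
  imports Defs
begin

text \<open>
  Let \<open>R\<^sub>n\<close> be the operator that maps the initial error to the mean of \<open>m\<^sub>n - u\<close>. Multiplying the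
  precision form of the filter by \<open>S\<close> gives \<open>(\<alpha> + n S A* A) R\<^sub>n v = \<alpha> v\<close>.

  Bias: put \<open>\<beta> = \<alpha> / n = \<delta> powr (a + 1)\<close> and split \<open>v\<close> at the eigenvalue \<open>\<delta>\<close> of \<open>S\<close>. For the part
  above \<open>\<delta>\<close>, test the equation with the solution itself; for the part below \<open>\<delta>\<close>, test it with the
  difference of the data and the solution. Both energies \<open>|A x|\<^sup>2 + \<beta> |S powr (-1/2) x|\<^sup>2\<close>
  control \<open>|x|\<^sup>2\<close> because \<open>1 \<le> (\<lambda> / \<delta>) powr a + \<delta> / \<lambda>\<close>. This elementary interpolation replaces the
  Heinz inequality for fractional powers of \<open>A* A\<close>.

  Variance: by the Joseph form of the covariance update, the noise part of \<open>\<langle>m\<^sub>n - u, x\<rangle>\<close> has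
  variance at most \<open>\<langle>C\<^sub>n x, x\<rangle> \<le> \<langle>C\<^sub>0 x, x\<rangle>\<close>. Summing over an orthonormal basis gives \<open>tr C\<^sub>0\<close>.
\<close>

section \<open>Hilbert space preliminaries\<close>

text \<open>The threshold \<delta> balances the energy: at an eigenvalue \<lambda> the data term has
  size \<open>\<lambda> powr a\<close> and the penalty \<open>\<beta> / \<lambda>\<close>, and the
  two agree at \<lambda> = \<delta>. The splitting is forced by smoothness. Testing with the
  solution pairs it with a preimage of the data under \<open>S\<close>, and a general
  \<open>v\<close> is not in the range of \<open>S\<close>. Above \<delta> the finite trace leaves
  finitely many eigenvalues, so the preimage is a finite sum; below \<delta> only the norms of
  \<open>v\<close> and \<open>A v\<close> enter, and both are small. The limit
  \<open>s \<le> a + 2\<close> comes from absorbing the right-hand side, which needs a norm with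
  weight \<open>\<lambda> powr (s - 2)\<close>; the energy controls such weights for exponents
  between \<open>-1\<close> and \<open>a\<close>.

  White noise is not \<open>'y\<close>-valued, so the filter is known only through almost sure
  identities for single inner products, with null sets that depend on the test vector. The
  stochastic part is therefore done coordinate by coordinate and assembled by monotone convergence
  over a countable basis; countability comes from the finite trace and the injectivity of
  \<open>S\<close>.\<close>

lemma Cauchy_Schwarz_positive:
  assumes "positive_selfadjoint S"
  shows "(S x \<bullet> y)\<^sup>2 \<le> (S x \<bullet> x) * (S y \<bullet> y)"
proof -
  interpret bounded_linear S using assms by (simp add: positive_selfadjoint_def)
  have sym: "S u \<bullet> v = u \<bullet> S v" and pos: "0 \<le> S u \<bullet> u" for u v
    using assms by (auto simp: positive_selfadjoint_def)
  define p q r where "p = S x \<bullet> x" and "q = S x \<bullet> y" and "r = S y \<bullet> y"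
  have q': "S y \<bullet> x = q" by (metis q_def sym inner_commute)
  have quad: "0 \<le> p + 2 * t * q + t\<^sup>2 * r" for t
    using pos[of "x + t *\<^sub>R y"] q'
    by (simp add: add scale inner_add_left inner_add_right p_def q_def r_def algebra_simps power2_eq_square)
  have "q\<^sup>2 \<le> p * r"
  proof (cases "r = 0")
    case True
    have "q = 0"
    proof (rule ccontr)
      assume "q \<noteq> 0"
      then obtain t where "t * q = - (p + 1)"
        by (metis nonzero_divide_eq_eq)
      with quad[of "t / 2"] True show False by simp
    qed
    then show ?thesis using True by simp
  next
    case False
    then have "r > 0" using pos[of y] by (simp add: r_def)
    define t where "t = - q / r"
    have tr: "t * r = - q" using \<open>r > 0\<close> by (simp add: t_def)
    have "0 \<le> r * (p + 2 * t * q + t\<^sup>2 * r)" using quad[of t] \<open>r > 0\<close> by simp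
    also have "\<dots> = p * r + 2 * (t * r) * q + (t * r)\<^sup>2" by (simp add: algebra_simps power2_eq_square)
    finally show ?thesis unfolding tr by (simp add: power2_eq_square)
  qed
  then show ?thesis by (simp add: p_def q_def r_def)
qed

section \<open>Nearest points, Riesz representation and adjoints\<close>

text \<open>Points of \<open>V\<close> whose distance to some \<open>x\<close> outside
  \<open>V\<close> tends to the infimum form a Cauchy sequence by the parallelogram law, because
  midpoints stay in \<open>V\<close>. The vector from the limit \<open>l\<close> to \<open>x\<close>
  is the one sought: moving \<open>l\<close> inside \<open>V\<close> cannot bring it closer to
  \<open>x\<close>.\<close>

lemma orthogonal_to_closed_subspace:
  fixes V :: "'x::{real_inner,banach} set"
  assumes "subspace V" "closed V" "V \<noteq> UNIV"
  obtains y where "y \<noteq> 0" "\<And>v. v \<in> V \<Longrightarrow> v \<bullet> y = 0"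
proof -
  obtain x where x: "x \<notin> V" using assms(3) by auto
  have ne: "V \<noteq> {}" using assms(1) subspace_0 by auto
  define d where "d = infdist x V"
  have dpos: "d > 0" using x assms(2) ne unfolding d_def by (simp add: infdist_pos_not_in_closed)
  have dle: "d\<^sup>2 \<le> (norm (x - v))\<^sup>2" if "v \<in> V" for v
    using infdist_le[OF that, of x] infdist_nonneg[of x V] unfolding d_def dist_norm by (intro power_mono)
  have "\<exists>v\<in>V. (norm (x - v))\<^sup>2 < d\<^sup>2 + 1 / real (Suc n)" for n
  proof -
    have "sqrt (d\<^sup>2 + 1 / real (Suc n)) > d" using dpos by (intro real_less_rsqrt) auto
    moreover have "d = (INF v\<in>V. dist x v)" using ne by (simp add: d_def infdist_def)
    ultimately obtain v where v: "v \<in> V" "dist x v < sqrt (d\<^sup>2 + 1 / real (Suc n))"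
      using cINF_less_iff[OF ne bdd_belowI2[of V 0 "dist x", OF zero_le_dist], of "sqrt (d\<^sup>2 + 1 / real (Suc n))"]
      by metis
    have "(dist x v)\<^sup>2 < (sqrt (d\<^sup>2 + 1 / real (Suc n)))\<^sup>2"
      using v(2) by (intro power_strict_mono) auto
    then show ?thesis using v(1) by (auto simp: dist_norm)
  qed
  then obtain p where p: "\<And>n. p n \<in> V" "\<And>n. (norm (x - p n))\<^sup>2 < d\<^sup>2 + 1 / real (Suc n)"
    by metis
  have close: "(norm (p m - p n))\<^sup>2 \<le> 2 / real (Suc m) + 2 / real (Suc n)" for m n
  proof -
    have mid: "(1/2) *\<^sub>R (p m + p n) \<in> V"
      using p assms(1) by (intro subspace_scale subspace_add)
    have "(norm (p m - p n))\<^sup>2 = 2 * (norm (x - p m))\<^sup>2 + 2 * (norm (x - p n))\<^sup>2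
            - 4 * (norm (x - (1/2) *\<^sub>R (p m + p n)))\<^sup>2"
      unfolding power2_norm_eq_inner
      by (simp add: inner_diff_left inner_diff_right inner_add_left inner_add_right algebra_simps inner_commute)
    with p(2)[of m] p(2)[of n] dle[OF mid] show ?thesis by linarith
  qed
  have "Cauchy p"
  proof (rule metric_CauchyI)
    fix e :: real assume "0 < e"
    then obtain N where N: "inverse (real (Suc N)) < e\<^sup>2 / 4"
      using reals_Archimedean[of "e\<^sup>2 / 4"] by auto
    show "\<exists>M. \<forall>m\<ge>M. \<forall>n\<ge>M. dist (p m) (p n) < e"
    proof (intro exI allI impI)
      fix m n assume "m \<ge> N" "n \<ge> N"
      then have "1 / real (Suc m) \<le> 1 / real (Suc N)" "1 / real (Suc n) \<le> 1 / real (Suc N)"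
        by (auto intro!: divide_left_mono)
      moreover have "1 / real (Suc N) < e\<^sup>2 / 4" using N by (simp only: inverse_eq_divide)
      moreover have "2 / real (Suc m) = 2 * (1 / real (Suc m))" "2 / real (Suc n) = 2 * (1 / real (Suc n))"
        by simp_all
      ultimately have "(norm (p m - p n))\<^sup>2 < e\<^sup>2" using close[of m n] by linarith
      then show "dist (p m) (p n) < e"
        using \<open>0 < e\<close> by (auto simp: dist_norm intro: power_less_imp_less_base)
    qed
  qed
  then obtain l where l: "p \<longlonglongrightarrow> l" using Cauchy_convergent convergent_def by blast
  have lV: "l \<in> V" using closed_sequentially[OF assms(2) _ l] p(1) by blast
  have "(\<lambda>n. (norm (x - p n))\<^sup>2) \<longlonglongrightarrow> (norm (x - l))\<^sup>2" by (intro tendsto_intros l)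
  moreover have "(\<lambda>n. d\<^sup>2 + 1 / real (Suc n)) \<longlonglongrightarrow> d\<^sup>2 + 0"
    by (intro tendsto_intros LIMSEQ_Suc[OF lim_1_over_n])
  ultimately have nd: "(norm (x - l))\<^sup>2 \<le> d\<^sup>2"
    using p(2) by (intro LIMSEQ_le[of "\<lambda>n. (norm (x - p n))\<^sup>2" _ "\<lambda>n. d\<^sup>2 + 1 / real (Suc n)" "d\<^sup>2"])
      (auto intro!: exI[of _ 0] less_imp_le)
  have "v \<bullet> (x - l) = 0" if v: "v \<in> V" for v
  proof (cases "v = 0")
    case False
    \<comment> \<open>The minimiser of \<open>norm ((x - l) - t *\<^sub>R v)\<close> over
      \<open>t\<close>.\<close>
    define t where "t = (v \<bullet> (x - l)) / (v \<bullet> v)"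
    have vv: "v \<bullet> v > 0" using False by simp
    have "l + t *\<^sub>R v \<in> V" using lV v assms(1) by (intro subspace_add subspace_scale)
    from nd dle[OF this] have "(norm (x - l))\<^sup>2 \<le> (norm ((x - l) - t *\<^sub>R v))\<^sup>2"
      unfolding diff_diff_eq by (rule order_trans)
    also have "\<dots> = (norm (x - l))\<^sup>2 - 2 * t * (v \<bullet> (x - l)) + t\<^sup>2 * (v \<bullet> v)"
      unfolding power2_norm_eq_inner
      by (simp add: inner_diff_left inner_diff_right algebra_simps inner_commute power2_eq_square)
    also have "\<dots> = (norm (x - l))\<^sup>2 - (v \<bullet> (x - l))\<^sup>2 / (v \<bullet> v)"
    proof -
      have tv: "t * (v \<bullet> v) = v \<bullet> (x - l)" using vv by (simp add: t_def)
      have "t\<^sup>2 * (v \<bullet> v) = t * (v \<bullet> (x - l))" by (simp only: tv[symmetric] power2_eq_square mult.assoc)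
      moreover have "(v \<bullet> (x - l))\<^sup>2 / (v \<bullet> v) = t * (v \<bullet> (x - l))" by (simp add: t_def power2_eq_square)
      ultimately show ?thesis by simp
    qed
    finally have "(v \<bullet> (x - l))\<^sup>2 / (v \<bullet> v) \<le> 0" by simp
    then show ?thesis using vv by (simp add: divide_le_0_iff)
  qed simp
  moreover have "x - l \<noteq> 0" using x lV by auto
  ultimately show ?thesis using that by blast
qed

text \<open>A nonzero vector orthogonal to the kernel represents \<open>f\<close> up to a factor,
  because every \<open>x\<close> differs from a multiple of it by an element of the kernel.\<close>

theorem Riesz_representation:
  fixes f :: "'x::{real_inner,banach} \<Rightarrow> real"
  assumes "bounded_linear f"
  obtains z where "\<And>x. f x = x \<bullet> z"
proof (cases "\<forall>x. f x = 0")
  case True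
  then show ?thesis using that[of 0] by simp
next
  case False
  interpret bounded_linear f by fact
  let ?V = "{x. f x = 0}"
  have sub: "subspace ?V" by (auto simp: subspace_def add scale zero)
  have cl: "closed ?V" by (intro closed_Collect_eq continuous_on continuous_intros)
  have ne: "?V \<noteq> UNIV" using False by auto
  obtain y where y: "y \<noteq> 0" "\<And>v. v \<in> ?V \<Longrightarrow> v \<bullet> y = 0"
    using orthogonal_to_closed_subspace[OF sub cl ne] by blast
  have fy: "f y \<noteq> 0" using y by force
  have "f x = x \<bullet> ((f y / (y \<bullet> y)) *\<^sub>R y)" for x
  proof -
    have "x - (f x / f y) *\<^sub>R y \<in> ?V" using fy by (simp add: diff scale)
    from y(2)[OF this] have "x \<bullet> y = (f x / f y) * (y \<bullet> y)" by (simp add: inner_diff_left)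
    then show ?thesis using y(1) fy by simp
  qed
  then show ?thesis using that by blast
qed

text \<open>\<open>adjoint\<close> is a choice among the maps with this property, so the identity
  holds once some such map exists; the Riesz theorem provides one.\<close>

lemma adjoint_inner:
  fixes A :: "'x::{real_inner,banach} \<Rightarrow> 'y::real_inner"
  assumes "bounded_linear A"
  shows "A x \<bullet> y = x \<bullet> adjoint A y"
proof -
  have "\<exists>z. \<forall>x. A x \<bullet> y = x \<bullet> z" for y
  proof -
    have "bounded_linear (\<lambda>x. A x \<bullet> y)"
      by (rule bounded_linear_compose[OF bounded_linear_inner_left assms])
    from Riesz_representation[OF this] show ?thesis by metis
  qed
  then obtain g where "\<forall>y x. A x \<bullet> y = x \<bullet> g y" by metis
  then show ?thesis using adjoint_unique[of A g] by metis
qed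

lemma bounded_linear_adjoint:
  fixes A :: "'x::{real_inner,banach} \<Rightarrow> 'y::real_inner"
  assumes "bounded_linear A"
  shows "bounded_linear (adjoint A)"
proof -
  obtain K where K: "\<And>x. norm (A x) \<le> norm x * K" "K \<ge> 0"
    using bounded_linear.nonneg_bounded[OF assms] by blast
  note adj = adjoint_inner[OF assms, symmetric]
  show ?thesis
  proof (rule bounded_linear_intro[where K = K])
    show "adjoint A (x + y) = adjoint A x + adjoint A y" for x y
      by (rule vector_eq_ldot[THEN iffD1]) (simp add: adj inner_add_right)
    show "adjoint A (r *\<^sub>R x) = r *\<^sub>R adjoint A x" for r x
      by (rule vector_eq_ldot[THEN iffD1]) (simp add: adj)
    fix y
    have "(norm (adjoint A y))\<^sup>2 = A (adjoint A y) \<bullet> y"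
      by (simp add: power2_norm_eq_inner adj)
    also have "\<dots> \<le> norm (A (adjoint A y)) * norm y" by (rule norm_cauchy_schwarz)
    also have "\<dots> \<le> (norm (adjoint A y) * K) * norm y" by (intro mult_right_mono K) auto
    finally have "norm (adjoint A y) * norm (adjoint A y) \<le> norm (adjoint A y) * (norm y * K)"
      by (simp add: power2_eq_square ac_simps)
    then show "norm (adjoint A y) \<le> norm y * K"
      using K(2) by (cases "adjoint A y = 0") auto
  qed
qed

section \<open>Inverses of coercive operators\<close>

text \<open>The Lax-Milgram argument: a solution of \<open>G h = y\<close> is a fixed point of
  \<open>h - t (G h - y)\<close>, which coercivity makes a contraction for a suitable
  \<open>t\<close>. This turns the \<open>inv\<close> inside \<open>kalman_gain\<close> into a true
  inverse.\<close>

lemma coercive_bij: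
  fixes G :: "'x::{real_inner,banach} \<Rightarrow> 'x"
  assumes "bounded_linear G" "k > 0" and coer: "\<And>h. k * (norm h)\<^sup>2 \<le> G h \<bullet> h"
  shows "bij G"
proof -
  interpret bounded_linear G by fact
  have "h = 0" if "G h = 0" for h
    using coer[of h] that \<open>k > 0\<close> by (auto simp: mult_le_0_iff)
  then have inj: "inj G" by (metis diff right_minus_eq injI)
  obtain L0 where L0: "\<And>x. norm (G x) \<le> norm x * L0" using bounded by blast
  \<comment> \<open>A bound of at least \<open>k\<close> keeps
    \<open>1 - k\<^sup>2 / L\<^sup>2\<close> nonnegative.\<close>
  define L where "L = max (max L0 k) 1"
  have L: "norm (G x) \<le> norm x * L" for x
    using L0[of x] by (rule order_trans) (auto simp: L_def intro!: mult_left_mono)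
  have Lpos: "L > 0" and kL: "k \<le> L" by (auto simp: L_def)
  \<comment> \<open>\<open>t\<close> minimises \<open>1 - 2 * t * k + t\<^sup>2 * L\<^sup>2\<close>;
    the minimum is the squared contraction factor \<open>q\<^sup>2\<close>.\<close>
  define t where "t = k / L\<^sup>2"
  define q where "q = sqrt (1 - k\<^sup>2 / L\<^sup>2)"
  have q0: "0 \<le> 1 - k\<^sup>2 / L\<^sup>2" using kL \<open>k > 0\<close> Lpos by (simp add: power_mono)
  have q1: "0 \<le> q" "q < 1" using q0 \<open>k>0\<close> Lpos by (auto simp: q_def)
  have contr: "norm (h - t *\<^sub>R G h) \<le> q * norm h" for h
  proof (rule power2_le_imp_le)
    have "(norm (h - t *\<^sub>R G h))\<^sup>2 = (norm h)\<^sup>2 - 2 * t * (G h \<bullet> h) + t\<^sup>2 * (norm (G h))\<^sup>2"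
      unfolding power2_norm_eq_inner
      by (simp add: inner_diff_left inner_diff_right algebra_simps inner_commute power2_eq_square)
    also have "\<dots> \<le> (norm h)\<^sup>2 - 2 * t * (k * (norm h)\<^sup>2) + t\<^sup>2 * (norm h * L)\<^sup>2"
      using \<open>k > 0\<close> by (intro add_mono diff_mono mult_left_mono coer power_mono L) (auto simp: t_def)
    also have "\<dots> = (q * norm h)\<^sup>2"
      using Lpos q0 by (simp add: power_mult_distrib q_def t_def field_simps power2_eq_square)
    finally show "(norm (h - t *\<^sub>R G h))\<^sup>2 \<le> (q * norm h)\<^sup>2" .
  qed (use q1 in auto)
  have "\<exists>h. y = G h" for y
  proof -
    let ?f = "\<lambda>h. h - t *\<^sub>R (G h - y)"
    have "\<exists>!h. ?f h = h"
    proof (rule banach_fix_type[where c = q])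
      have "dist (?f h) (?f h') \<le> q * dist h h'" for h h'
      proof -
        have "?f h - ?f h' = (h - h') - t *\<^sub>R G (h - h')" by (simp add: diff algebra_simps)
        then show ?thesis using contr[of "h - h'"] by (simp only: dist_norm)
      qed
      then show "\<forall>h h'. dist (?f h) (?f h') \<le> q * dist h h'" by blast
    qed (use q1 in auto)
    then obtain h where "t *\<^sub>R (G h - y) = 0" by (metis add_diff_cancel_left' diff_add_cancel diff_self)
    moreover have "t \<noteq> 0" using \<open>k > 0\<close> Lpos by (simp add: t_def)
    ultimately show ?thesis by auto
  qed
  then have "surj G" by (auto simp: surj_def)
  with inj show ?thesis by (simp add: bij_def)
qed

lemma bounded_linear_inv_coercive:
  fixes G :: "'x::{real_inner,banach} \<Rightarrow> 'x"
  assumes "bounded_linear G" "k > 0" and coer: "\<And>h. k * (norm h)\<^sup>2 \<le> G h \<bullet> h"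
  shows "bounded_linear (inv G)"
proof -
  interpret bounded_linear G by fact
  have b: "bij G" by (rule coercive_bij[OF assms])
  have GI: "G (inv G y) = y" and IG: "inv G (G y) = y" for y
    using b by (auto simp: bij_is_surj surj_f_inv_f bij_is_inj)
  show ?thesis
  proof (rule bounded_linear_intro[where K = "1 / k"])
    show "inv G (x + y) = inv G x + inv G y" for x y by (metis GI IG add)
    show "inv G (r *\<^sub>R x) = r *\<^sub>R inv G x" for r x by (metis GI IG scale)
    fix y
    have "k * (norm (inv G y))\<^sup>2 \<le> y \<bullet> inv G y" using coer[of "inv G y"] by (simp add: GI)
    also have "\<dots> \<le> norm y * norm (inv G y)" by (rule norm_cauchy_schwarz)
    finally have "norm (inv G y) * (k * norm (inv G y)) \<le> norm (inv G y) * norm y"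
      by (simp add: power2_eq_square ac_simps)
    then show "norm (inv G y) \<le> norm y * (1 / k)"
      using \<open>k > 0\<close> by (cases "inv G y = 0") (auto simp: field_simps)
  qed
qed

section \<open>Orthonormal bases and the spectral theorem\<close>

lemma positive_selfadjointD:
  assumes "positive_selfadjoint S"
  shows "bounded_linear S" "S x \<bullet> y = x \<bullet> S y" "0 \<le> S x \<bullet> x"
  using assms unfolding positive_selfadjoint_def by blast+

text \<open>Kept apart from \<open>orthonormal_basis\<close> so that Zorn's lemma can range over
  families whose span is not yet dense.\<close>

definition orthonormal :: "'x::real_inner set \<Rightarrow> bool" where
  "orthonormal B \<longleftrightarrow> pairwise orthogonal B \<and> (\<forall>e\<in>B. norm e = 1)"

lemma orthonormal_inner:
  assumes "orthonormal B" "e \<in> B" "f \<in> B"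
  shows "e \<bullet> f = (if e = f then 1 else 0)"
  using assms by (auto simp: orthonormal_def pairwise_def orthogonal_def norm_eq_1)

lemma orthonormal_basis_imp_orthonormal: "orthonormal_basis B \<Longrightarrow> orthonormal B"
  by (simp add: orthonormal_basis_def orthonormal_def)

lemma inner_sum_orthonormal:
  assumes "orthonormal B" "finite F" "F \<subseteq> B" "f \<in> B"
  shows "(\<Sum>e\<in>F. c e *\<^sub>R e) \<bullet> f = (if f \<in> F then c f else 0)"
proof -
  have "(\<Sum>e\<in>F. c e *\<^sub>R e) \<bullet> f = (\<Sum>e\<in>F. if e = f then c e else 0)"
    unfolding inner_sum_left using assms by (intro sum.cong) (auto simp: orthonormal_inner[OF assms(1)])
  then show ?thesis using assms(2) by simp
qed

text \<open>Completing the square in each coefficient shows that the Fourier coefficients give the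
  best approximation and what any other choice costs.\<close>

lemma norm_diff_sum_orthonormal:
  assumes "orthonormal B" "finite F" "F \<subseteq> B"
  shows "(norm (x - (\<Sum>e\<in>F. c e *\<^sub>R e)))\<^sup>2 =
           (norm x)\<^sup>2 - (\<Sum>e\<in>F. (x \<bullet> e)\<^sup>2) + (\<Sum>e\<in>F. (x \<bullet> e - c e)\<^sup>2)"
proof -
  let ?y = "\<Sum>e\<in>F. c e *\<^sub>R e"
  have xy: "x \<bullet> ?y = (\<Sum>e\<in>F. c e * (x \<bullet> e))" by (simp add: inner_sum_right)
  have "?y \<bullet> ?y = (\<Sum>e\<in>F. c e * (?y \<bullet> e))" by (simp add: inner_sum_right)
  also have "\<dots> = (\<Sum>e\<in>F. (c e)\<^sup>2)"
    using assms(3) by (intro sum.cong) (auto simp: inner_sum_orthonormal[OF assms] power2_eq_square subset_iff)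
  finally have yy: "?y \<bullet> ?y = (\<Sum>e\<in>F. (c e)\<^sup>2)" .
  have "(norm (x - ?y))\<^sup>2 = (norm x)\<^sup>2 - 2 * (x \<bullet> ?y) + ?y \<bullet> ?y"
    unfolding power2_norm_eq_inner by (simp only: inner_diff_left inner_diff_right inner_commute[of ?y x])
  also have "\<dots> = (norm x)\<^sup>2 - (\<Sum>e\<in>F. (x \<bullet> e)\<^sup>2) + (\<Sum>e\<in>F. (x \<bullet> e - c e)\<^sup>2)"
    unfolding xy yy
    by (simp add: power2_diff sum.distrib sum_subtractf sum_distrib_left algebra_simps)
  finally show ?thesis .
qed

lemma Bessel_inequality:
  assumes "orthonormal B" "finite F" "F \<subseteq> B"
  shows "(\<Sum>e\<in>F. (x \<bullet> e)\<^sup>2) \<le> (norm x)\<^sup>2"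
proof -
  have "0 \<le> (norm x)\<^sup>2 - (\<Sum>e\<in>F. (x \<bullet> e)\<^sup>2)"
    using norm_diff_sum_orthonormal[OF assms, of x "\<lambda>e. x \<bullet> e"] by (metis (no_types, lifting) add.right_neutral cancel_comm_monoid_add_class.diff_cancel sum.neutral zero_le_power2 power_zero_numeral)
  then show ?thesis by simp
qed

text \<open>Bessel's inequality is one half. For the other, density gives a finite combination close
  to \<open>x\<close>, and passing to Fourier coefficients only improves it.\<close>

theorem Parseval:
  assumes "orthonormal_basis B"
  shows "((\<lambda>e. (x \<bullet> e)\<^sup>2) has_sum (norm x)\<^sup>2) B"
proof -
  note on = orthonormal_basis_imp_orthonormal[OF assms]
  have summ: "(\<lambda>e. (x \<bullet> e)\<^sup>2) summable_on B"
    using Bessel_inequality[OF on]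
    by (intro nonneg_bdd_above_summable_on bdd_aboveI2[of _ _ "(norm x)\<^sup>2"]) auto
  have le: "(\<Sum>\<^sub>\<infinity>e\<in>B. (x \<bullet> e)\<^sup>2) \<le> (norm x)\<^sup>2"
    using Bessel_inequality[OF on] by (intro infsum_le_finite_sums summ) auto
  have "(norm x)\<^sup>2 \<le> (\<Sum>\<^sub>\<infinity>e\<in>B. (x \<bullet> e)\<^sup>2) + r" if "r > 0" for r
  proof -
    have "x \<in> closure (span B)" using assms by (simp add: orthonormal_basis_def)
    then obtain y where y: "y \<in> span B" "dist y x < sqrt r"
      using closure_approachable[of x "span B"] real_sqrt_gt_zero[of r] \<open>r > 0\<close> by blast
    from y(1) obtain F c where F: "finite F" "F \<subseteq> B" "y = (\<Sum>e\<in>F. c e *\<^sub>R e)"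
      unfolding span_explicit by blast
    have "(norm x)\<^sup>2 - (\<Sum>e\<in>F. (x \<bullet> e)\<^sup>2) \<le> (norm (x - y))\<^sup>2"
      using norm_diff_sum_orthonormal[OF on F(1,2), of x c] F(3) sum_nonneg[of F "\<lambda>e. (x \<bullet> e - c e)\<^sup>2"]
      by simp
    also have "\<dots> \<le> (sqrt r)\<^sup>2"
      using y(2) by (intro power_mono) (auto simp: dist_norm norm_minus_commute)
    also have "\<dots> = r" using that by simp
    finally show ?thesis using finite_sum_le_infsum[OF summ F(1,2)] by force
  qed
  then have "(norm x)\<^sup>2 \<le> (\<Sum>\<^sub>\<infinity>e\<in>B. (x \<bullet> e)\<^sup>2)" by (rule field_le_epsilon)
  with le summ show ?thesis by (simp add: has_sum_iff)
qed

lemma Parseval_inner: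
  assumes "orthonormal_basis B"
  shows "((\<lambda>e. (x \<bullet> e) * (y \<bullet> e)) has_sum (x \<bullet> y)) B"
proof -
  have "((\<lambda>e. (1/4) * (((x + y) \<bullet> e)\<^sup>2 + - ((x - y) \<bullet> e)\<^sup>2)) has_sum
          ((1/4) * ((norm (x + y))\<^sup>2 + - (norm (x - y))\<^sup>2))) B"
    by (intro has_sum_cmult_right has_sum_add has_sum_uminusI Parseval assms)
  moreover have "(1/4) * (((x + y) \<bullet> e)\<^sup>2 + - ((x - y) \<bullet> e)\<^sup>2) = (x \<bullet> e) * (y \<bullet> e)" for e
    by (simp add: inner_add_left inner_diff_left power2_eq_square algebra_simps)
  moreover have "(1/4) * ((norm (x + y))\<^sup>2 + - (norm (x - y))\<^sup>2) = x \<bullet> y"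
    unfolding power2_norm_eq_inner
    by (simp add: inner_add_left inner_add_right inner_diff_left inner_diff_right inner_commute)
  ultimately show ?thesis by simp
qed

lemma has_sum_orthonormal_basis:
  assumes "orthonormal_basis B"
  shows "((\<lambda>e. (x \<bullet> e) *\<^sub>R e) has_sum x) B"
proof -
  note on = orthonormal_basis_imp_orthonormal[OF assms]
  have "((\<lambda>F. (norm x)\<^sup>2 - (\<Sum>e\<in>F. (x \<bullet> e)\<^sup>2)) \<longlongrightarrow> (norm x)\<^sup>2 - (norm x)\<^sup>2) (finite_subsets_at_top B)"
    using Parseval[OF assms, of x] unfolding has_sum_def by (intro tendsto_intros)
  then have "((\<lambda>F. sqrt ((norm x)\<^sup>2 - (\<Sum>e\<in>F. (x \<bullet> e)\<^sup>2))) \<longlongrightarrow> 0) (finite_subsets_at_top B)"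
    using tendsto_real_sqrt by fastforce
  moreover have "\<forall>\<^sub>F F in finite_subsets_at_top B.
      sqrt ((norm x)\<^sup>2 - (\<Sum>e\<in>F. (x \<bullet> e)\<^sup>2)) = dist (\<Sum>e\<in>F. (x \<bullet> e) *\<^sub>R e) x"
  proof (rule eventually_finite_subsets_at_top_weakI)
    fix F assume "finite F" "F \<subseteq> B"
    from norm_diff_sum_orthonormal[OF on this, of x "\<lambda>e. x \<bullet> e"]
    have "(norm x)\<^sup>2 - (\<Sum>e\<in>F. (x \<bullet> e)\<^sup>2) = (dist (\<Sum>e\<in>F. (x \<bullet> e) *\<^sub>R e) x)\<^sup>2"
      by (simp add: dist_norm norm_minus_commute)
    then show "sqrt ((norm x)\<^sup>2 - (\<Sum>e\<in>F. (x \<bullet> e)\<^sup>2)) = dist (\<Sum>e\<in>F. (x \<bullet> e) *\<^sub>R e) x"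
      by simp
  qed
  ultimately have "((\<lambda>F. dist (\<Sum>e\<in>F. (x \<bullet> e) *\<^sub>R e) x) \<longlongrightarrow> 0) (finite_subsets_at_top B)"
    by (simp add: tendsto_cong)
  then show ?thesis unfolding has_sum_def using tendsto_dist_iff by blast
qed

lemma summable_on_mult_squares:
  fixes f g :: "'a \<Rightarrow> real"
  assumes "(\<lambda>e. (f e)\<^sup>2) summable_on B" "(\<lambda>e. (g e)\<^sup>2) summable_on B"
  shows "(\<lambda>e. f e * g e) summable_on B"
proof -
  have "(\<lambda>e. ((f e)\<^sup>2 + (g e)\<^sup>2)) summable_on B" by (intro summable_on_add assms)
  then have "(\<lambda>e. norm (f e * g e)) summable_on B"
  proof (rule summable_on_comparison_test)
    fix e
    have "2 * (\<bar>f e\<bar> * \<bar>g e\<bar>) \<le> \<bar>f e\<bar>\<^sup>2 + \<bar>g e\<bar>\<^sup>2" using sum_squares_bound[of "\<bar>f e\<bar>" "\<bar>g e\<bar>"] by (simp add: ac_simps)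
    moreover have "0 \<le> \<bar>f e\<bar> * \<bar>g e\<bar>" by simp
    ultimately have "\<bar>f e\<bar> * \<bar>g e\<bar> \<le> (f e)\<^sup>2 + (g e)\<^sup>2" unfolding power2_abs by linarith
    then show "norm (f e * g e) \<le> (f e)\<^sup>2 + (g e)\<^sup>2" by (simp add: abs_mult)
  qed auto
  then show ?thesis by (rule abs_summable_summable)
qed

text \<open>The limit is found by duality: \<open>z\<close> is the Riesz representative of the
  functional \<open>f\<close> with \<open>f y = \<Sum> c e * (y \<bullet> e)\<close>, and its
  Fourier expansion is the series in question.\<close>

theorem Riesz_Fischer:
  fixes B :: "'x::{real_inner,banach} set"
  assumes B: "orthonormal_basis B" and c: "(\<lambda>e. (c e)\<^sup>2) summable_on B"
  obtains z where "\<And>e. e \<in> B \<Longrightarrow> z \<bullet> e = c e" "((\<lambda>e. c e *\<^sub>R e) has_sum z) B"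
proof -
  have sq: "(\<lambda>e. (y \<bullet> e)\<^sup>2) summable_on B" for y
    using Parseval[OF B] by (rule has_sum_imp_summable)
  have sm: "(\<lambda>e. c e * (y \<bullet> e)) summable_on B" for y
    by (intro summable_on_mult_squares c sq)
  define f where "f y = (\<Sum>\<^sub>\<infinity>e\<in>B. c e * (y \<bullet> e))" for y
  define K where "K = (\<Sum>\<^sub>\<infinity>e\<in>B. (c e)\<^sup>2)"
  have K: "((\<lambda>e. (c e)\<^sup>2) has_sum K) B" using c by (simp add: K_def)
  have fs: "((\<lambda>e. c e * (y \<bullet> e)) has_sum f y) B" for y using sm by (simp add: f_def)
  have fadd: "f (x + y) = f x + f y" for x y
    using has_sum_add[OF fs[of x] fs[of y]] fs[of "x + y"]
    by (auto simp: inner_add_left algebra_simps intro: has_sum_unique)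
  have fscale: "f (r *\<^sub>R x) = r * f x" for r x
    using has_sum_cmult_right[OF fs[of x], of r] fs[of "r *\<^sub>R x"]
    by (auto simp: algebra_simps intro: has_sum_unique)
  \<comment> \<open>The bound \<open>2 p q \<le> p\<^sup>2 + q\<^sup>2\<close> applied termwise; on
    the unit sphere the right-hand side is constant, and homogeneity then makes \<open>f\<close>
    bounded.\<close>
  have f1: "f y \<le> (K + (norm y)\<^sup>2) / 2" for y
  proof -
    have "((\<lambda>e. ((c e)\<^sup>2 + (y \<bullet> e)\<^sup>2) / 2) has_sum ((K + (norm y)\<^sup>2) / 2)) B"
      by (intro has_sum_divide_const has_sum_add K Parseval B)
    with fs[of y] show ?thesis
      by (rule has_sum_mono) (use sum_squares_bound in \<open>auto simp: field_simps\<close>)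
  qed
  have f2: "\<bar>f y\<bar> \<le> (K + (norm y)\<^sup>2) / 2" for y
    using f1[of y] f1[of "- y"] fscale[of "-1" y] by auto
  have "bounded_linear f"
  proof (rule bounded_linear_intro[where K = "(K + 1) / 2"])
    fix y
    show "norm (f y) \<le> norm y * ((K + 1) / 2)"
    proof (cases "y = 0")
      case True then show ?thesis using fscale[of 0 0] by simp
    next
      case False
      have "\<bar>f ((1 / norm y) *\<^sub>R y)\<bar> \<le> (K + 1) / 2"
        using f2[of "(1 / norm y) *\<^sub>R y"] False by simp
      then have "\<bar>f y\<bar> / norm y \<le> (K + 1) / 2" by (simp add: fscale abs_mult)
      then show ?thesis using False by (simp add: pos_divide_le_eq mult.commute)
    qed
  qed (use fadd fscale in auto)
  then obtain z where z: "\<And>x. f x = x \<bullet> z" using Riesz_representation by blast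
  have ze: "z \<bullet> e = c e" if "e \<in> B" for e
  proof -
    have "f e = c e"
    proof (rule has_sum_unique[OF fs])
      show "((\<lambda>e'. c e' * (e \<bullet> e')) has_sum c e) B"
        by (rule has_sum_finite_neutralI[of "{e}"])
          (use that orthonormal_inner[OF orthonormal_basis_imp_orthonormal[OF B] that] in auto)
    qed
    then show ?thesis using z[of e] by (simp add: inner_commute)
  qed
  have "((\<lambda>e. c e *\<^sub>R e) has_sum z) B"
    using has_sum_orthonormal_basis[OF B, of z] by (rule has_sum_cong[THEN iffD1, rotated]) (simp add: ze)
  with ze that show ?thesis by blast
qed

section \<open>Compactness of positive trace class operators\<close>

text \<open>Truncations of bounded vectors to finitely many basis vectors lie in such a box, which
  supplies the finite nets for total boundedness. Each further vector adds a segment, and a sum of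
  two compact sets is compact.\<close>

lemma compact_box_span:
  fixes F :: "'x::real_normed_vector set"
  assumes "finite F"
  shows "compact {(\<Sum>e\<in>F. c e *\<^sub>R e) | c. \<forall>e\<in>F. \<bar>c e\<bar> \<le> M}"
  using assms
proof induction
  case empty
  then show ?case by simp
next
  case (insert f F)
  have "compact ((\<lambda>t. t *\<^sub>R f) ` {-M..M})"
    by (intro compact_continuous_image continuous_intros compact_Icc)
  from compact_sums[OF this insert.IH]
  have "compact {x + y | x y. x \<in> (\<lambda>t. t *\<^sub>R f) ` {-M..M} \<and> y \<in> {(\<Sum>e\<in>F. c e *\<^sub>R e) | c. \<forall>e\<in>F. \<bar>c e\<bar> \<le> M}}" .
  also have "{x + y | x y. x \<in> (\<lambda>t. t *\<^sub>R f) ` {-M..M} \<and> y \<in> {(\<Sum>e\<in>F. c e *\<^sub>R e) | c. \<forall>e\<in>F. \<bar>c e\<bar> \<le> M}}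
      = {(\<Sum>e\<in>insert f F. c e *\<^sub>R e) | c. \<forall>e\<in>insert f F. \<bar>c e\<bar> \<le> M}" (is "?L = ?R")
  proof (intro equalityI subsetI)
    fix z assume "z \<in> ?L"
    then obtain t c where t: "\<bar>t\<bar> \<le> M" and c: "\<forall>e\<in>F. \<bar>c e\<bar> \<le> M" and z: "z = t *\<^sub>R f + (\<Sum>e\<in>F. c e *\<^sub>R e)"
      by (smt (verit) abs_le_iff atLeastAtMost_iff imageE mem_Collect_eq)
    have "(\<Sum>e\<in>insert f F. (c(f := t)) e *\<^sub>R e) = t *\<^sub>R f + (\<Sum>e\<in>F. (c(f := t)) e *\<^sub>R e)"
      using insert.hyps by simp
    also have "(\<Sum>e\<in>F. (c(f := t)) e *\<^sub>R e) = (\<Sum>e\<in>F. c e *\<^sub>R e)"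
      using insert.hyps by (intro sum.cong) auto
    finally show "z \<in> ?R" using t c z by (intro CollectI exI[of _ "c(f := t)"]) auto
  next
    fix z assume "z \<in> ?R"
    then obtain c where c: "\<forall>e\<in>insert f F. \<bar>c e\<bar> \<le> M" "z = c f *\<^sub>R f + (\<Sum>e\<in>F. c e *\<^sub>R e)"
      using insert.hyps by auto
    then show "z \<in> ?L" by (fastforce simp: abs_le_iff)
  qed
  finally show ?case .
qed

text \<open>Total boundedness: truncations of \<open>S x\<close> stay in a compact box, and the
  tails are small uniformly in the unit ball, because Cauchy-Schwarz for the form of
  \<open>S\<close> gives \<open>(S x \<bullet> e)\<^sup>2 \<le> L * (S e \<bullet> e)\<close> and
  the right-hand side is a multiple of the trace series.\<close>

lemma positive_trace_class_compact:
  fixes S :: "'x::{real_inner,banach} \<Rightarrow> 'x"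
  assumes "positive_trace_class S"
  shows "compact (closure (S ` cball 0 1))"
proof -
  have psa: "positive_selfadjoint S" using assms by (simp add: positive_trace_class_def)
  then interpret bounded_linear S by (simp add: positive_selfadjoint_def)
  have pos: "0 \<le> S x \<bullet> x" for x by (rule positive_selfadjointD[OF psa])
  obtain B where B: "orthonormal_basis B" and sm: "(\<lambda>e. S e \<bullet> e) summable_on B"
    using assms by (auto simp: positive_trace_class_def)
  note on = orthonormal_basis_imp_orthonormal[OF B]
  obtain L0 where L0: "\<And>x. norm (S x) \<le> norm x * L0" using bounded by blast
  define L where "L = max L0 1"
  have L1: "L \<ge> 1" by (simp add: L_def)
  have L: "norm (S x) \<le> L" if "norm x \<le> 1" for x
  proof -
    have "norm x * L0 \<le> norm x * L" by (intro mult_left_mono) (auto simp: L_def)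
    also have "\<dots> \<le> 1 * L" using that L1 by (intro mult_right_mono) auto
    finally show ?thesis using L0[of x] by simp
  qed
  have Sxx: "S x \<bullet> x \<le> L" if "norm x \<le> 1" for x
  proof -
    have "S x \<bullet> x \<le> norm (S x) * norm x" by (rule norm_cauchy_schwarz)
    also have "\<dots> \<le> L * 1" using that L L1 by (intro mult_mono) auto
    finally show ?thesis by simp
  qed
  have fin: "\<exists>k. finite k \<and> S ` cball 0 1 \<subseteq> (\<Union>z\<in>k. ball z (2 * r))" if "r > 0" for r
  proof -
    \<comment> \<open>The tolerance is chosen so that \<open>L\<close> times the tail of the trace
      is at most \<open>r\<^sup>2 / 2\<close>, strictly below \<open>r\<^sup>2\<close>.\<close>
    obtain F where F: "finite F" "F \<subseteq> B" and app: "dist (sum (\<lambda>e. S e \<bullet> e) F) (infsum (\<lambda>e. S e \<bullet> e) B) \<le> r\<^sup>2 / (2 * L)"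
      using infsum_finite_approximation[OF sm, of "r\<^sup>2 / (2 * L)"] \<open>r > 0\<close> L1 by auto
    define T where "T = {(\<Sum>e\<in>F. c e *\<^sub>R e) | c. \<forall>e\<in>F. \<bar>c e\<bar> \<le> L}"
    have "compact T" unfolding T_def by (rule compact_box_span) fact
    then obtain k where k: "finite k" "T \<subseteq> (\<Union>z\<in>k. ball z r)"
      using \<open>r > 0\<close> compact_eq_totally_bounded by blast
    have tail: "infsum (\<lambda>e. S e \<bullet> e) (B - F) \<le> r\<^sup>2 / (2 * L)"
    proof -
      have "infsum (\<lambda>e. S e \<bullet> e) B = sum (\<lambda>e. S e \<bullet> e) F + infsum (\<lambda>e. S e \<bullet> e) (B - F)"
        using infsum_Un_disjoint[of "\<lambda>e. S e \<bullet> e" F "B - F"] F sm summable_on_subset_banach[OF sm, of "B - F"]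
        by (simp add: Un_absorb1)
      then show ?thesis using app by (simp add: dist_real_def)
    qed
    have "S x \<in> (\<Union>z\<in>k. ball z (2 * r))" if x: "norm x \<le> 1" for x
    proof -
      let ?p = "\<Sum>e\<in>F. (S x \<bullet> e) *\<^sub>R e"
      have "\<bar>S x \<bullet> e\<bar> \<le> L" if "e \<in> F" for e
      proof -
        have "norm e = 1" using that F(2) on by (auto simp: orthonormal_def)
        then show ?thesis using Cauchy_Schwarz_ineq2[of "S x" e] L[OF x] by simp
      qed
      then have "?p \<in> T" unfolding T_def by auto
      then obtain z where z: "z \<in> k" "dist z ?p < r" using k(2) by auto
      have "(norm (S x - ?p))\<^sup>2 = (norm (S x))\<^sup>2 - (\<Sum>e\<in>F. (S x \<bullet> e)\<^sup>2)"
        using norm_diff_sum_orthonormal[OF on F, of "S x" "\<lambda>e. S x \<bullet> e"] by simp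
      also have "\<dots> = infsum (\<lambda>e. (S x \<bullet> e)\<^sup>2) (B - F)"
      proof -
        have s: "(\<lambda>e. (S x \<bullet> e)\<^sup>2) summable_on B" using Parseval[OF B] has_sum_imp_summable by blast
        have "infsum (\<lambda>e. (S x \<bullet> e)\<^sup>2) B = sum (\<lambda>e. (S x \<bullet> e)\<^sup>2) F + infsum (\<lambda>e. (S x \<bullet> e)\<^sup>2) (B - F)"
          using infsum_Un_disjoint[of "\<lambda>e. (S x \<bullet> e)\<^sup>2" F "B - F"] F s summable_on_subset_banach[OF s, of "B - F"]
          by (simp add: Un_absorb1)
        moreover have "infsum (\<lambda>e. (S x \<bullet> e)\<^sup>2) B = (norm (S x))\<^sup>2" using Parseval[OF B] by (rule infsumI)
        ultimately show ?thesis by simp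
      qed
      also have "\<dots> \<le> infsum (\<lambda>e. L * (S e \<bullet> e)) (B - F)"
      proof (rule infsum_mono)
        show "(\<lambda>e. (S x \<bullet> e)\<^sup>2) summable_on B - F"
          using has_sum_imp_summable[OF Parseval[OF B, of "S x"]] by (rule summable_on_subset_banach) auto
        show "(\<lambda>e. L * (S e \<bullet> e)) summable_on B - F"
          by (intro summable_on_cmult_right summable_on_subset_banach[OF sm]) auto
        fix e
        show "(S x \<bullet> e)\<^sup>2 \<le> L * (S e \<bullet> e)"
          using Cauchy_Schwarz_positive[OF psa, of x e] mult_right_mono[OF Sxx[OF x] pos[of e]] by simp
      qed
      also have "\<dots> = L * infsum (\<lambda>e. S e \<bullet> e) (B - F)" by (rule infsum_cmult_right')
      also have "\<dots> \<le> L * (r\<^sup>2 / (2 * L))" using tail L1 by (intro mult_left_mono) auto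
      also have "\<dots> < r\<^sup>2" using L1 \<open>r > 0\<close> by simp
      finally have "norm (S x - ?p) < r" using \<open>r > 0\<close> power_less_imp_less_base by force
      then have "dist z (S x) < 2 * r"
        using z(2) dist_triangle[of z "S x" ?p] by (simp add: dist_norm norm_minus_commute)
      then show ?thesis using z(1) by auto
    qed
    then show ?thesis using k(1) by (intro exI[of _ k]) auto
  qed
  have "\<exists>k. finite k \<and> closure (S ` cball 0 1) \<subseteq> (\<Union>z\<in>k. ball z r)" if "0 < r" for r
  proof -
    \<comment> \<open>Balls of radius \<open>r / 2\<close> leave room: their closed versions cover
      the closure and still fit into open balls of radius \<open>r\<close>.\<close>
    from that obtain k where k: "finite k" "S ` cball 0 1 \<subseteq> (\<Union>z\<in>k. ball z (2 * (r / 4)))"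
      using fin[of "r / 4"] by auto
    have "S ` cball 0 1 \<subseteq> (\<Union>z\<in>k. cball z (r / 2))"
      using k(2) by (force simp: subset_iff)
    moreover have "closed (\<Union>z\<in>k. cball z (r / 2))" using k(1) by (intro closed_UN) auto
    ultimately have "closure (S ` cball 0 1) \<subseteq> (\<Union>z\<in>k. cball z (r / 2))" by (rule closure_minimal)
    also have "\<dots> \<subseteq> (\<Union>z\<in>k. ball z r)" using \<open>0 < r\<close> by (force simp: subset_iff)
    finally show ?thesis using k(1) by blast
  qed
  then show ?thesis unfolding compact_eq_totally_bounded by (simp add: complete_eq_closed)
qed

section \<open>The spectral theorem for injective positive trace class operators\<close>

text \<open>If \<open>S x \<bullet> x\<close> vanished, Cauchy-Schwarz for the form of
  \<open>S\<close>, tested with \<open>S x\<close>, would give \<open>S x = 0\<close>.\<close>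

lemma injective_positive_definite:
  assumes "positive_selfadjoint S" "inj S" "x \<noteq> 0"
  shows "S x \<bullet> x > 0"
proof -
  interpret bounded_linear S using assms(1) by (simp add: positive_selfadjoint_def)
  have "S x \<noteq> 0" using assms(2,3) zero by (metis injD)
  moreover have "S x = 0" if "S x \<bullet> x = 0"
    using Cauchy_Schwarz_positive[OF assms(1), of x "S x"] that by simp
  ultimately show ?thesis using assms(1) unfolding positive_selfadjoint_def by (metis less_le)
qed

text \<open>The eigenvalue is the supremum \<open>l\<close> of the Rayleigh quotient on
  \<open>V\<close>, positive because \<open>V\<close> is nontrivial and \<open>S\<close> injective.
  Invariance of \<open>V\<close> gives
  \<open>(norm (S x))\<^sup>2 \<le> l * (S x \<bullet> x)\<close>, so a maximising sequence
  satisfies the eigenvalue equation in the limit. Compactness makes a subsequence of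
  \<open>S (x n)\<close> converge, and dividing by \<open>l\<close> carries this over to
  \<open>x n\<close>.\<close>

lemma eigenvector_in_invariant_subspace:
  fixes S :: "'x::{real_inner,banach} \<Rightarrow> 'x"
  assumes psa: "positive_selfadjoint S" and "inj S" and cpt: "compact (closure (S ` cball 0 1))"
    and V: "subspace V" "closed V" "\<And>x. x \<in> V \<Longrightarrow> S x \<in> V" and "w \<in> V" "w \<noteq> 0"
  obtains e l where "e \<in> V" "norm e = 1" "S e = l *\<^sub>R e"
proof -
  interpret bounded_linear S using psa by (simp add: positive_selfadjoint_def)
  have pos: "0 \<le> S x \<bullet> x" for x by (rule positive_selfadjointD[OF psa])
  let ?U = "{x \<in> V. norm x = 1}"
  define l where "l = (SUP x\<in>?U. S x \<bullet> x)"
  obtain L where L: "\<And>x. norm (S x) \<le> norm x * L" using bounded by blast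
  have bdd: "bdd_above ((\<lambda>x. S x \<bullet> x) ` ?U)"
  proof (rule bdd_aboveI2)
    fix x assume "x \<in> ?U"
    then show "S x \<bullet> x \<le> L" using norm_cauchy_schwarz[of "S x" x] L[of x] by simp
  qed
  have w': "(1 / norm w) *\<^sub>R w \<in> ?U" using \<open>w \<in> V\<close> \<open>w \<noteq> 0\<close> V(1) by (simp add: subspace_scale)
  have lU: "S x \<bullet> x \<le> l" if "x \<in> ?U" for x
    unfolding l_def using bdd that by (rule cSUP_upper2[OF _ _ order_refl])
  have "0 < S ((1 / norm w) *\<^sub>R w) \<bullet> ((1 / norm w) *\<^sub>R w)"
    using \<open>w \<noteq> 0\<close> by (intro injective_positive_definite psa \<open>inj S\<close>) simp
  also have "\<dots> \<le> l" by (rule lU) fact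
  finally have "l > 0" .
  have lV: "S x \<bullet> x \<le> l * (norm x)\<^sup>2" if "x \<in> V" for x
  proof (cases "x = 0")
    case False
    have "(1 / norm x) *\<^sub>R x \<in> ?U" using that False V(1) by (simp add: subspace_scale)
    from lU[OF this] have "(S x \<bullet> x) / (norm x)\<^sup>2 \<le> l" by (simp add: scale power2_eq_square)
    then show ?thesis using False by (simp add: pos_divide_le_eq)
  qed (simp add: zero)
  have nS: "(norm (S x))\<^sup>2 \<le> l * (S x \<bullet> x)" if "x \<in> V" for x
  proof (cases "S x = 0")
    case False
    have "((norm (S x))\<^sup>2)\<^sup>2 \<le> (S x \<bullet> x) * (S (S x) \<bullet> S x)"
      using Cauchy_Schwarz_positive[OF psa, of x "S x"] by (simp add: power2_norm_eq_inner)
    also have "\<dots> \<le> (S x \<bullet> x) * (l * (norm (S x))\<^sup>2)"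
      using V(3)[OF that] by (intro mult_left_mono lV pos)
    finally have "(norm (S x))\<^sup>2 * (norm (S x))\<^sup>2 \<le> (l * (S x \<bullet> x)) * (norm (S x))\<^sup>2"
      by (simp only: power2_eq_square ac_simps)
    then show ?thesis using False by (metis mult_le_cancel_right_pos norm_eq_zero zero_less_power2)
  qed (simp add: pos)
  have "\<exists>x\<in>?U. l - 1 / real (Suc n) < S x \<bullet> x" for n
  proof -
    have "l - 1 / real (Suc n) < l" by simp
    then show ?thesis using less_cSUP_iff[OF _ bdd, of "l - 1 / real (Suc n)"] w' unfolding l_def[symmetric] by blast
  qed
  then obtain x where x: "\<And>n. x n \<in> ?U" "\<And>n. l - 1 / real (Suc n) < S (x n) \<bullet> x n" by metis
  have "S (x n) \<in> closure (S ` cball 0 1)" for n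
    using x(1)[of n] closure_subset[of "S ` cball 0 1"] by auto
  then obtain y r where y: "strict_mono (r :: nat \<Rightarrow> nat)" "((\<lambda>n. S (x n)) \<circ> r) \<longlonglongrightarrow> y"
    using cpt unfolding compact_def by metis
  have "(\<lambda>n. l * (1 / real (Suc n))) \<longlonglongrightarrow> l * 0"
    by (intro tendsto_intros LIMSEQ_Suc[OF lim_1_over_n])
  then have z: "(\<lambda>n. sqrt (l * (1 / real (Suc n)))) \<longlonglongrightarrow> 0"
    using tendsto_real_sqrt by fastforce
  have "norm (S (x n) - l *\<^sub>R x n) \<le> sqrt (l * (1 / real (Suc n)))" for n
  proof (rule real_le_rsqrt)
    have xn: "x n \<in> V" "norm (x n) = 1" using x(1)[of n] by auto
    have "(norm (S (x n) - l *\<^sub>R x n))\<^sup>2 = (norm (S (x n)))\<^sup>2 - 2 * l * (S (x n) \<bullet> x n) + l\<^sup>2 * (norm (x n))\<^sup>2"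
      unfolding power2_norm_eq_inner
      by (simp add: inner_diff_left inner_diff_right algebra_simps inner_commute power2_eq_square)
    also have "\<dots> \<le> l * (S (x n) \<bullet> x n) - 2 * l * (S (x n) \<bullet> x n) + l\<^sup>2"
      using nS[OF xn(1)] xn(2) by simp
    also have "\<dots> = l * (l - S (x n) \<bullet> x n)" by (simp add: algebra_simps power2_eq_square)
    also have "\<dots> \<le> l * (1 / real (Suc n))" using x(2)[of n] \<open>l > 0\<close> by (intro mult_left_mono) auto
    finally show "(norm (S (x n) - l *\<^sub>R x n))\<^sup>2 \<le> l * (1 / real (Suc n))" .
  qed
  then have d: "(\<lambda>n. S (x n) - l *\<^sub>R x n) \<longlonglongrightarrow> 0"
    by (intro Lim_null_comparison[OF _ z] always_eventually) auto
  have "(\<lambda>n. (1 / l) *\<^sub>R (S (x (r n)) - (S (x (r n)) - l *\<^sub>R x (r n)))) \<longlonglongrightarrow> (1 / l) *\<^sub>R (y - 0)"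
    using y(2) LIMSEQ_subseq_LIMSEQ[OF d y(1)] by (intro tendsto_intros) (auto simp: o_def)
  then have xr: "(\<lambda>n. x (r n)) \<longlonglongrightarrow> (1 / l) *\<^sub>R y" using \<open>l > 0\<close> by simp
  define e where "e = (1 / l) *\<^sub>R y"
  have "e \<in> V" using closed_sequentially[OF V(2) _ xr] x(1) by (auto simp: e_def)
  moreover have "norm e = 1"
  proof -
    have "(\<lambda>n. norm (x (r n))) = (\<lambda>n. 1)" using x(1) by auto
    with tendsto_norm[OF xr] have "(\<lambda>n. 1) \<longlonglongrightarrow> norm e" unfolding e_def by metis
    then show ?thesis by (simp add: LIMSEQ_const_iff)
  qed
  moreover have "S e = l *\<^sub>R e"
  proof -
    have "(\<lambda>n. S (x (r n))) \<longlonglongrightarrow> S e" unfolding e_def by (rule tendsto[OF xr])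
    moreover have "(\<lambda>n. S (x (r n))) \<longlonglongrightarrow> y" using y(2) by (simp add: o_def)
    ultimately have "S e = y" by (rule LIMSEQ_unique)
    then show ?thesis using \<open>l > 0\<close> by (simp add: e_def)
  qed
  ultimately show ?thesis using that by blast
qed

lemma subspace_closure_normed:
  fixes V :: "'x::real_normed_vector set"
  assumes "subspace V"
  shows "subspace (closure V)"
  unfolding subspace_def
proof (intro conjI ballI allI)
  show "0 \<in> closure V" using subspace_0[OF assms] closure_subset by blast
  fix x assume "x \<in> closure V"
  then obtain p where p: "\<And>n. p n \<in> V" "p \<longlonglongrightarrow> x" unfolding closure_sequential by blast
  show "x + y \<in> closure V" if "y \<in> closure V" for y
  proof -
    obtain q where q: "\<And>n. q n \<in> V" "q \<longlonglongrightarrow> y" using \<open>y \<in> closure V\<close> unfolding closure_sequential by auto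
    have "(\<lambda>n. p n + q n) \<longlonglongrightarrow> x + y" by (intro tendsto_intros p q)
    moreover have "p n + q n \<in> V" for n using assms p q by (simp add: subspace_add)
    ultimately show ?thesis unfolding closure_sequential by (intro exI[of _ "\<lambda>n. p n + q n"]) auto
  qed
  show "c *\<^sub>R x \<in> closure V" for c
  proof -
    have "(\<lambda>n. c *\<^sub>R p n) \<longlonglongrightarrow> c *\<^sub>R x" by (intro tendsto_intros p)
    moreover have "c *\<^sub>R p n \<in> V" for n using assms p by (simp add: subspace_scale)
    ultimately show ?thesis unfolding closure_sequential by (intro exI[of _ "\<lambda>n. c *\<^sub>R p n"]) auto
  qed
qed

text \<open>Zorn's lemma for orthonormal families of eigenvectors. By symmetry of \<open>S\<close>
  the orthogonal complement of a maximal family is invariant; if it were nontrivial, it would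
  contain one more eigenvector.\<close>

theorem eigenbasis_exists:
  fixes S :: "'x::{real_inner,banach} \<Rightarrow> 'x"
  assumes tc: "positive_trace_class S" and "inj S"
  shows "\<exists>B. eigenbasis S B"
proof -
  have psa: "positive_selfadjoint S" using tc by (simp add: positive_trace_class_def)
  interpret bounded_linear S using psa by (simp add: positive_selfadjoint_def)
  have sym: "S x \<bullet> y = x \<bullet> S y" for x y by (rule positive_selfadjointD[OF psa])
  define W where "W = {B. orthonormal B \<and> (\<forall>e\<in>B. \<exists>l. S e = l *\<^sub>R e)}"
  have "\<exists>M\<in>W. \<forall>X\<in>W. M \<subseteq> X \<longrightarrow> X = M"
  proof (rule subset_Zorn_nonempty)
    have "{} \<in> W" by (simp add: W_def orthonormal_def)
    then show "W \<noteq> {}" by blast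
    fix \<C> assume "\<C> \<noteq> {}" and ch: "subset.chain W \<C>"
    have "orthogonal e f" if "X \<in> \<C>" "Y \<in> \<C>" "e \<in> X" "f \<in> Y" "e \<noteq> f" for e f X Y
    proof -
      have "X \<subseteq> Y \<or> Y \<subseteq> X" "X \<in> W" "Y \<in> W" using ch that by (auto simp: subset_chain_def)
      then show ?thesis using that unfolding W_def orthonormal_def pairwise_def by blast
    qed
    then have "pairwise orthogonal (\<Union>\<C>)" unfolding pairwise_def by blast
    moreover have "\<C> \<subseteq> W" using ch by (simp add: subset_chain_def)
    ultimately show "\<Union>\<C> \<in> W" by (auto simp: W_def orthonormal_def)
  qed
  then obtain M where M: "M \<in> W" and max: "\<And>X. X \<in> W \<Longrightarrow> M \<subseteq> X \<Longrightarrow> X = M" by blast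
  have "closure (span M) = UNIV"
  proof (rule ccontr)
    assume "closure (span M) \<noteq> UNIV"
    then obtain w where w: "w \<noteq> 0" "\<And>v. v \<in> closure (span M) \<Longrightarrow> v \<bullet> w = 0"
      using orthogonal_to_closed_subspace[of "closure (span M)"] by (metis closed_closure subspace_closure_normed subspace_span)
    let ?V = "{x. \<forall>e\<in>M. e \<bullet> x = 0}"
    have V: "subspace ?V" by (auto simp: subspace_def inner_add_right)
    have "?V = (\<Inter>e\<in>M. {x. e \<bullet> x = 0})" by auto
    then have cl: "closed ?V" by (auto intro!: closed_Collect_eq continuous_intros)
    have inv: "S x \<in> ?V" if "x \<in> ?V" for x
    proof (intro CollectI ballI)
      fix e assume e: "e \<in> M"
      then obtain l where "S e = l *\<^sub>R e" using M by (auto simp: W_def)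
      then show "e \<bullet> S x = 0" using that e sym[of e x] by simp
    qed
    have "M \<subseteq> closure (span M)" using span_superset closure_subset by blast
    then have "w \<in> ?V" using w(2) by blast
    from eigenvector_in_invariant_subspace[OF psa \<open>inj S\<close> positive_trace_class_compact[OF tc] V cl inv this w(1)]
    obtain e l where e: "e \<in> ?V" "norm e = 1" "S e = l *\<^sub>R e" by blast
    have "insert e M \<in> W"
      using M e by (auto simp: W_def orthonormal_def pairwise_insert orthogonal_def inner_commute)
    from max[OF this] have "e \<in> M" by blast
    then show False using e by auto
  qed
  then show ?thesis using M by (auto simp: W_def eigenbasis_def orthonormal_basis_def orthonormal_def)
qed

lemma eigenbasis_eigenvalue:
  assumes "eigenbasis S E" "f \<in> E"
  shows "S f = (S f \<bullet> f) *\<^sub>R f"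
proof -
  have "norm f = 1" using assms by (simp add: eigenbasis_def orthonormal_basis_def)
  moreover obtain l where "S f = l *\<^sub>R f" using assms unfolding eigenbasis_def by blast
  ultimately show ?thesis by (simp add: norm_eq_1)
qed

text \<open>Tonelli for the nonnegative family
  \<open>g e f = (S f \<bullet> f) * (e \<bullet> f)\<^sup>2\<close>: summing over \<open>f\<close>
  gives \<open>S e \<bullet> e\<close>, summing over \<open>e\<close> gives
  \<open>S f \<bullet> f\<close>. It is needed because the trace class condition speaks of some
  basis, whereas \<open>op_trace\<close> sums over a chosen one and an infinite sum without
  convergence has the value 0.\<close>

lemma summable_diagonal_basis_change:
  fixes S :: "'x::{real_inner,banach} \<Rightarrow> 'x"
  assumes psa: "positive_selfadjoint S" and E: "eigenbasis S E" and B: "orthonormal_basis B"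
  shows "(\<lambda>e. S e \<bullet> e) summable_on B \<longleftrightarrow> (\<lambda>e. S e \<bullet> e) summable_on E"
proof -
  interpret bounded_linear S using psa by (simp add: positive_selfadjoint_def)
  have pos: "0 \<le> S x \<bullet> x" and sym: "S x \<bullet> y = x \<bullet> S y" for x y
    by (rule positive_selfadjointD[OF psa])+
  have oE: "orthonormal_basis E" using E by (simp add: eigenbasis_def)
  note eig = eigenbasis_eigenvalue[OF E]
  define g where "g e f = (S f \<bullet> f) * (e \<bullet> f)\<^sup>2" for e f
  have gpos: "0 \<le> g e f" for e f using pos by (simp add: g_def)
  have 1: "((\<lambda>f. g e f) has_sum (S e \<bullet> e)) E" for e
  proof -
    have "(S e \<bullet> f) * (e \<bullet> f) = g e f" if "f \<in> E" for f
    proof -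
      have "S e \<bullet> f = e \<bullet> ((S f \<bullet> f) *\<^sub>R f)" using sym[of e f] eig[OF that] by simp
      then show ?thesis by (simp add: g_def power2_eq_square)
    qed
    then show ?thesis using Parseval_inner[OF oE, of "S e" e] by (simp cong: has_sum_cong)
  qed
  have 2: "((\<lambda>e. g e f) has_sum (S f \<bullet> f)) B" if "f \<in> E" for f
  proof -
    have "norm f = 1" using that oE by (simp add: orthonormal_basis_def)
    then show ?thesis
      using has_sum_cmult_right[OF Parseval[OF B, of f], of "S f \<bullet> f"] by (simp add: g_def inner_commute)
  qed
  have "(\<lambda>e. S e \<bullet> e) summable_on B \<longleftrightarrow> (\<lambda>(e, f). g e f) summable_on (B \<times> E)"
  proof
    assume "(\<lambda>e. S e \<bullet> e) summable_on B"
    then show "(\<lambda>(e, f). g e f) summable_on (B \<times> E)"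
      using 1 gpos by (intro summable_on_SigmaI[where g = "\<lambda>e. S e \<bullet> e"]) auto
  next
    assume "(\<lambda>(e, f). g e f) summable_on (B \<times> E)"
    from summable_on_SigmaD[OF this] has_sum_imp_summable[OF 1]
    have "(\<lambda>e. infsum (g e) E) summable_on B" by simp
    then show "(\<lambda>e. S e \<bullet> e) summable_on B" by (simp add: infsumI[OF 1])
  qed
  also have "\<dots> \<longleftrightarrow> (\<lambda>(f, e). g e f) summable_on (E \<times> B)"
    using summable_on_swap[of "\<lambda>(e, f). g e f" B E] by (simp add: case_prod_beta')
  also have "\<dots> \<longleftrightarrow> (\<lambda>e. S e \<bullet> e) summable_on E"
  proof
    assume "(\<lambda>e. S e \<bullet> e) summable_on E"
    then show "(\<lambda>(f, e). g e f) summable_on (E \<times> B)"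
      using 2 gpos by (intro summable_on_SigmaI[where g = "\<lambda>e. S e \<bullet> e"]) auto
  next
    assume "(\<lambda>(f, e). g e f) summable_on (E \<times> B)"
    from summable_on_SigmaD[OF this] has_sum_imp_summable[OF 2]
    have "(\<lambda>f. infsum (\<lambda>e. g e f) B) summable_on E" by simp
    then show "(\<lambda>e. S e \<bullet> e) summable_on E"
      by (rule summable_on_cong[THEN iffD1, rotated]) (simp add: infsumI[OF 2])
  qed
  finally show ?thesis .
qed

section \<open>Bias of Tikhonov regularization in the Hilbert scale of S\<close>

lemma has_sum_dominated:
  fixes f g :: "'a \<Rightarrow> real"
  assumes "(f has_sum W) E" "\<And>e. e \<in> E \<Longrightarrow> 0 \<le> g e" "\<And>e. e \<in> E \<Longrightarrow> g e \<le> k * f e"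
  shows "g summable_on E" "infsum g E \<le> k * W"
proof -
  have h: "((\<lambda>e. k * f e) has_sum k * W) E" by (rule has_sum_cmult_right) fact
  show s: "g summable_on E"
    by (rule summable_on_comparison_test[OF has_sum_imp_summable[OF h]]) (use assms in auto)
  show "infsum g E \<le> k * W"
    by (rule has_sum_mono[OF has_sum_infsum[OF s] h]) (use assms in auto)
qed

text \<open>Both summands equal \<open>d powr p\<close> at \<open>l = d\<close>; the first dominates
  above \<open>d\<close>, the second below.\<close>

lemma powr_interpolation:
  fixes l d p a :: real
  assumes "0 < l" "0 < d" "-1 \<le> p" "p \<le> a"
  shows "l powr p \<le> d powr (p - a) * l powr a + d powr (p + 1) * l powr (-1)"
proof (cases "d \<le> l")
  case True
  have "l powr p = l powr (p - a) * l powr a" by (simp flip: powr_add)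
  also have "\<dots> \<le> d powr (p - a) * l powr a"
    using assms True by (intro mult_right_mono powr_mono2') auto
  finally show ?thesis using assms by (simp add: add_increasing2)
next
  case False
  have "l powr p = l powr (p + 1) * l powr (-1)" by (simp only: powr_add[symmetric]) simp
  also have "\<dots> \<le> d powr (p + 1) * l powr (-1)"
    using assms False by (intro mult_right_mono powr_mono2) auto
  finally show ?thesis using assms by (simp add: add_increasing)
qed

lemma norm_add_squared_le:
  fixes x y :: "'x::real_inner"
  shows "(norm (x + y))\<^sup>2 \<le> 2 * (norm x)\<^sup>2 + 2 * (norm y)\<^sup>2"
proof -
  have "(norm (x + y))\<^sup>2 + (norm (x - y))\<^sup>2 = 2 * (norm x)\<^sup>2 + 2 * (norm y)\<^sup>2"
    unfolding power2_norm_eq_inner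
    by (simp add: inner_add_left inner_add_right inner_diff_left inner_diff_right)
  then show ?thesis using zero_le_power2[of "norm (x - y)"] by linarith
qed

section \<open>Eigenvalues and real powers of S\<close>

locale injective_trace_class =
  fixes S :: "'x::{real_inner,banach} \<Rightarrow> 'x"
  assumes tc: "positive_trace_class S" and inj: "inj S"
begin

text \<open>The same choice term as in \<open>op_powr\<close> and \<open>op_powr_domain\<close>, so
  that their series run over exactly this basis.\<close>

definition E :: "'x set" where "E = (SOME B. eigenbasis S B)"

definition lam :: "'x \<Rightarrow> real" where "lam e = S e \<bullet> e"

lemma psa: "positive_selfadjoint S"
  using tc by (simp add: positive_trace_class_def)

sublocale S: bounded_linear S
  by (rule positive_selfadjointD[OF psa])

lemma S_sym: "S x \<bullet> y = x \<bullet> S y"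
  by (rule positive_selfadjointD[OF psa])

lemma S_nonneg: "0 \<le> S x \<bullet> x"
  by (rule positive_selfadjointD[OF psa])

lemma eigenbasis_E: "eigenbasis S E"
  unfolding E_def using eigenbasis_exists[OF tc inj] by (rule someI_ex)

lemma basis_E: "orthonormal_basis E"
  using eigenbasis_E by (simp add: eigenbasis_def)

lemma orthonormal_E: "orthonormal E"
  by (rule orthonormal_basis_imp_orthonormal[OF basis_E])

lemma norm_E: "e \<in> E \<Longrightarrow> norm e = 1"
  using orthonormal_E by (simp add: orthonormal_def)

lemma S_eigen: "e \<in> E \<Longrightarrow> S e = lam e *\<^sub>R e"
  unfolding lam_def by (rule eigenbasis_eigenvalue[OF eigenbasis_E])

lemma lam_pos: "e \<in> E \<Longrightarrow> 0 < lam e"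
  unfolding lam_def using norm_E by (intro injective_positive_definite psa inj) force

lemma S_inner_E: "e \<in> E \<Longrightarrow> S x \<bullet> e = lam e * (x \<bullet> e)"
  using S_sym[of x e] by (simp add: S_eigen)

lemma summable_trace: "orthonormal_basis B \<Longrightarrow> (\<lambda>e. S e \<bullet> e) summable_on B"
  using summable_diagonal_basis_change[OF psa eigenbasis_E] tc
  unfolding positive_trace_class_def by blast

text \<open>Every such eigenvector contributes at least \<open>d\<close> to the finite
  trace.\<close>

lemma finite_large_eigenvalues:
  assumes "d > 0"
  shows "finite {e \<in> E. d \<le> lam e}"
proof (rule ccontr)
  let ?F = "{e \<in> E. d \<le> lam e}"
  assume inf: "infinite ?F"
  have sm: "lam summable_on E" using summable_trace[OF basis_E] by (simp add: lam_def[abs_def])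
  obtain n :: nat where n: "infsum lam E < real n * d"
    using reals_Archimedean3[OF assms] by blast
  obtain G where G: "G \<subseteq> ?F" "finite G" "card G = n"
    using inf infinite_arbitrarily_large by blast
  have "real n * d \<le> sum lam G"
    using sum_mono[of G "\<lambda>_. d" lam] G by auto
  also have "\<dots> \<le> infsum lam E"
    using G lam_pos by (intro finite_sum_le_infsum sm) (auto intro: less_imp_le)
  finally show False using n by simp
qed

lemma lam_bounded:
  obtains L where "0 < L" "\<And>e. e \<in> E \<Longrightarrow> lam e \<le> L"
proof -
  obtain K where K: "0 < K" "\<And>x. norm (S x) \<le> norm x * K" using S.pos_bounded by blast
  have "lam e \<le> K" if "e \<in> E" for e
    using K(2)[of e] norm_cauchy_schwarz[of "S e" e] norm_E[OF that] by (simp add: lam_def)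
  with K(1) that show ?thesis by blast
qed

lemma powr_square: "0 < l \<Longrightarrow> (l powr t * y)\<^sup>2 = l powr (2 * t) * y\<^sup>2" for l t y :: real
  using powr_add[of l t t] by (simp add: power_mult_distrib power2_eq_square)

lemma norm_op_powr:
  assumes "0 \<le> t"
  shows "((\<lambda>e. lam e powr (2 * t) * (x \<bullet> e)\<^sup>2) has_sum (norm (op_powr S t x))\<^sup>2) E"
proof -
  obtain L where L: "0 < L" "\<And>e. e \<in> E \<Longrightarrow> lam e \<le> L" using lam_bounded by blast
  have sq: "(lam e powr t * (x \<bullet> e))\<^sup>2 = lam e powr (2 * t) * (x \<bullet> e)\<^sup>2" if "e \<in> E" for e
    using lam_pos[OF that] by (rule powr_square)
  have "(\<lambda>e. lam e powr (2 * t) * (x \<bullet> e)\<^sup>2) summable_on E"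
    by (rule has_sum_dominated(1)[OF Parseval[OF basis_E, of x], where k = "L powr (2 * t)"])
      (auto intro!: mult_right_mono powr_mono2 simp: assms L(2) less_imp_le[OF lam_pos])
  then have "(\<lambda>e. (lam e powr t * (x \<bullet> e))\<^sup>2) summable_on E"
    using sq by (simp cong: summable_on_cong)
  from Riesz_Fischer[OF basis_E this]
  obtain z where z: "\<And>e. e \<in> E \<Longrightarrow> z \<bullet> e = lam e powr t * (x \<bullet> e)"
      "((\<lambda>e. (lam e powr t * (x \<bullet> e)) *\<^sub>R e) has_sum z) E" by blast
  have "op_powr S t x = z"
    using infsumI[OF z(2)] by (simp add: op_powr_def op_powr_term_def[abs_def] E_def[symmetric] lam_def)
  moreover have "((\<lambda>e. lam e powr (2 * t) * (x \<bullet> e)\<^sup>2) has_sum (norm z)\<^sup>2) E"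
    using Parseval[OF basis_E, of z] by (rule has_sum_cong[THEN iffD1, rotated]) (simp add: z(1) sq)
  ultimately show ?thesis by simp
qed

text \<open>Membership in the domain is convergence in norm. Continuity of the inner product
  identifies the coordinates of the limit, and Parseval turns them into a convergent real
  series.\<close>

lemma op_powr_domain_summable:
  assumes "x \<in> op_powr_domain S t"
  shows "(\<lambda>e. lam e powr (2 * t) * (x \<bullet> e)\<^sup>2) summable_on E"
proof -
  let ?c = "\<lambda>e. lam e powr t * (x \<bullet> e)"
  have "(\<lambda>e. ?c e *\<^sub>R e) summable_on E"
    using assms by (simp add: op_powr_domain_def op_powr_term_def[abs_def] E_def[symmetric] lam_def)
  then obtain z where z: "((\<lambda>e. ?c e *\<^sub>R e) has_sum z) E" by (auto simp: summable_on_def)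
  have zf: "z \<bullet> f = ?c f" if "f \<in> E" for f
  proof (rule has_sum_unique)
    show "((\<lambda>e. (?c e *\<^sub>R e) \<bullet> f) has_sum z \<bullet> f) E"
      by (rule has_sum_bounded_linear[OF bounded_linear_inner_left z])
    show "((\<lambda>e. (?c e *\<^sub>R e) \<bullet> f) has_sum ?c f) E"
      by (rule has_sum_finite_neutralI[of "{f}"])
        (use that orthonormal_inner[OF orthonormal_E _ that] in auto)
  qed
  have "(\<lambda>e. (z \<bullet> e)\<^sup>2) summable_on E" using Parseval[OF basis_E] by (rule has_sum_imp_summable)
  then show ?thesis
    by (rule summable_on_cong[THEN iffD1, rotated]) (simp add: zf powr_square lam_pos)
qed

end

section \<open>Energy estimates and the bias\<close>

locale smoothing_operator = injective_trace_class S for S :: "'x::{real_inner,banach} \<Rightarrow> 'x" +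
  fixes A :: "'x \<Rightarrow> 'y::{real_inner,banach}" and a c :: real
  assumes A: "bounded_linear A" and a: "0 < a" and c: "1 \<le> c"
    and A_lower: "\<And>x. inverse c * norm (op_powr S (a / 2) x) \<le> norm (A x)"
    and A_upper: "\<And>x. norm (A x) \<le> c * norm (op_powr S (a / 2) x)"
begin

sublocale A: bounded_linear A by (rule A)

lemma A_adjoint: "A x \<bullet> y = x \<bullet> adjoint A y"
  by (rule adjoint_inner[OF A])

lemma op_powr_has_sum: "((\<lambda>e. lam e powr a * (x \<bullet> e)\<^sup>2) has_sum (norm (op_powr S (a / 2) x))\<^sup>2) E"
  using norm_op_powr[of "a / 2" x] a by simp

lemma op_powr_le_A: "(norm (op_powr S (a / 2) x))\<^sup>2 \<le> c\<^sup>2 * (norm (A x))\<^sup>2"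
proof -
  have "norm (op_powr S (a / 2) x) \<le> c * norm (A x)"
    using A_lower[of x] c by (simp add: field_simps)
  then have "(norm (op_powr S (a / 2) x))\<^sup>2 \<le> (c * norm (A x))\<^sup>2" by (intro power_mono) auto
  then show ?thesis by (simp add: power_mult_distrib)
qed

lemma A_le_op_powr: "(norm (A x))\<^sup>2 \<le> c\<^sup>2 * (norm (op_powr S (a / 2) x))\<^sup>2"
proof -
  have "(norm (A x))\<^sup>2 \<le> (c * norm (op_powr S (a / 2) x))\<^sup>2" by (intro power_mono A_upper) auto
  then show ?thesis by (simp add: power_mult_distrib)
qed

text \<open>\<open>powr_interpolation\<close> summed over the eigenvalues. For vectors
  \<open>S h\<close> the weight \<open>lam e powr (-1)\<close> yields
  \<open>(S h \<bullet> e) * (h \<bullet> e)\<close>, with sum \<open>S h \<bullet> h\<close>, so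
  the penalty is expressed without an inverse of \<open>S\<close>.\<close>

lemma interpolation:
  assumes "0 < d" "-1 \<le> p" "p \<le> a"
  shows "(\<lambda>e. lam e powr p * (S h \<bullet> e)\<^sup>2) summable_on E" (is "?f summable_on E")
    and "infsum (\<lambda>e. lam e powr p * (S h \<bullet> e)\<^sup>2) E
           \<le> d powr (p - a) * (c\<^sup>2 * (norm (A (S h)))\<^sup>2) + d powr (p + 1) * (S h \<bullet> h)"
proof -
  let ?g = "\<lambda>e. d powr (p - a) * (lam e powr a * (S h \<bullet> e)\<^sup>2) + d powr (p + 1) * ((S h \<bullet> e) * (h \<bullet> e))"
  have g: "(?g has_sum d powr (p - a) * (norm (op_powr S (a / 2) (S h)))\<^sup>2 + d powr (p + 1) * (S h \<bullet> h)) E"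
    by (intro has_sum_add has_sum_cmult_right op_powr_has_sum Parseval_inner basis_E)
  have fg: "?f e \<le> 1 * ?g e" if "e \<in> E" for e
  proof -
    note l = lam_pos[OF that]
    have "(S h \<bullet> e) * (h \<bullet> e) = lam e powr (-1) * (S h \<bullet> e)\<^sup>2"
      using l by (simp add: S_inner_E[OF that] powr_minus power2_eq_square field_simps)
    then have "?g e = (d powr (p - a) * lam e powr a + d powr (p + 1) * lam e powr (-1)) * (S h \<bullet> e)\<^sup>2"
      by (simp add: algebra_simps)
    then show ?thesis
      using mult_right_mono[OF powr_interpolation[OF l assms], of "(S h \<bullet> e)\<^sup>2"] by simp
  qed
  show "?f summable_on E" by (rule has_sum_dominated(1)[OF g _ fg]) auto
  have "infsum ?f E \<le> 1 * (d powr (p - a) * (norm (op_powr S (a / 2) (S h)))\<^sup>2 + d powr (p + 1) * (S h \<bullet> h))"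
    by (rule has_sum_dominated(2)[OF g _ fg]) auto
  also have "\<dots> \<le> d powr (p - a) * (c\<^sup>2 * (norm (A (S h)))\<^sup>2) + d powr (p + 1) * (S h \<bullet> h)"
    by (simp add: mult_left_mono op_powr_le_A)
  finally show "infsum ?f E \<le> d powr (p - a) * (c\<^sup>2 * (norm (A (S h)))\<^sup>2) + d powr (p + 1) * (S h \<bullet> h)" .
qed

lemma norm_le_energy:
  assumes "0 < d"
  shows "(norm (S h))\<^sup>2 \<le> c\<^sup>2 * d powr (- a) * ((norm (A (S h)))\<^sup>2 + d powr (a + 1) * (S h \<bullet> h))"
proof -
  have "((\<lambda>e. lam e powr 0 * (S h \<bullet> e)\<^sup>2) has_sum (norm (S h))\<^sup>2) E"
    using Parseval[OF basis_E, of "S h"] by (rule has_sum_cong[THEN iffD1, rotated]) (use lam_pos in force)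
  from infsumI[OF this] interpolation(2)[OF assms, of 0 h] a
  have "(norm (S h))\<^sup>2 \<le> d powr (- a) * (c\<^sup>2 * (norm (A (S h)))\<^sup>2) + d * (S h \<bullet> h)" using assms by simp
  also have "d * (S h \<bullet> h) \<le> c\<^sup>2 * (d * (S h \<bullet> h))"
    using mult_right_mono[of 1 "c\<^sup>2" "d * (S h \<bullet> h)"] c assms S_nonneg[of h] by (simp add: one_le_power)
  also have "c\<^sup>2 * (d * (S h \<bullet> h)) = c\<^sup>2 * (d powr (- a) * d powr (a + 1)) * (S h \<bullet> h)"
    using assms by (simp flip: powr_add)
  finally show ?thesis by (simp add: algebra_simps)
qed

text \<open>In the application \<open>z = v - R v\<close> and \<open>q\<close> is
  \<open>A (R v)\<close> divided by \<open>d powr (a + 1)\<close>. Pairing the equation with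
  \<open>A z\<close> bounds the whole energy by \<open>(norm (A v))\<^sup>2\<close>, without asking
  \<open>v\<close> to lie in the range of \<open>S\<close>.\<close>

lemma low_frequency_bound:
  assumes "0 < d" and z: "z = S (adjoint A q)" and eq: "A z + d powr (a + 1) *\<^sub>R q = A v"
  shows "(norm z)\<^sup>2 \<le> c\<^sup>2 * d powr (- a) * (norm (A v))\<^sup>2"
proof -
  let ?b = "d powr (a + 1)"
  have zq: "z \<bullet> adjoint A q = A z \<bullet> q" by (simp add: A_adjoint)
  then have pos: "0 \<le> A z \<bullet> q" using S_nonneg[of "adjoint A q"] by (simp add: z)
  have "(norm (A z))\<^sup>2 + ?b * (A z \<bullet> q) = A z \<bullet> A v"
    unfolding eq[symmetric] by (simp add: inner_add_right power2_norm_eq_inner)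
  also have "\<dots> \<le> norm (A z) * norm (A v)" by (rule norm_cauchy_schwarz)
  also have "\<dots> \<le> ((norm (A z))\<^sup>2 + (norm (A v))\<^sup>2) / 2"
    using sum_squares_bound[of "norm (A z)" "norm (A v)"] by simp
  finally have "(norm (A z))\<^sup>2 / 2 + ?b * (A z \<bullet> q) \<le> (norm (A v))\<^sup>2 / 2" by (simp add: field_simps)
  moreover have "0 \<le> ?b * (A z \<bullet> q)" using pos by simp
  ultimately have "(norm (A z))\<^sup>2 + ?b * (A z \<bullet> q) \<le> (norm (A v))\<^sup>2" by linarith
  then have "c\<^sup>2 * d powr (- a) * ((norm (A z))\<^sup>2 + ?b * (A z \<bullet> q)) \<le> c\<^sup>2 * d powr (- a) * (norm (A v))\<^sup>2"
    by (intro mult_left_mono) auto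
  then show ?thesis using norm_le_energy[OF assms(1), of "adjoint A q"] zq by (simp flip: z)
qed

text \<open>Pairing the equation with \<open>x = S h\<close> gives the energy on the left and a
  multiple of \<open>g \<bullet> x\<close> on the right. The product splits into \<open>S g\<close>
  with weight \<open>lam e powr (- t)\<close> and \<open>x\<close> with weight
  \<open>lam e powr (t - 2)\<close>. The second factor is absorbed by the energy through
  \<open>interpolation\<close>, whose condition \<open>-1 \<le> t - 2 \<le> a\<close> is the range
  allowed for \<open>t\<close>.\<close>

lemma high_frequency_bound:
  assumes d: "0 < d" and t: "1 \<le> t" "t \<le> a + 2"
    and eq: "d powr (a + 1) *\<^sub>R h + adjoint A (A (S h)) = d powr (a + 1) *\<^sub>R g"
    and V: "((\<lambda>e. lam e powr (- t) * (S g \<bullet> e)\<^sup>2) has_sum V) E"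
  shows "(norm (S h))\<^sup>2 \<le> c ^ 4 * d powr t * V"
proof -
  let ?b = "d powr (a + 1)"
  define x where "x = S h"
  \<comment> \<open>The Young weight for which the term in \<open>x\<close> is at most the energy
    itself: \<open>?b\<^sup>2 / K = d powr (a + 2 - t) / c\<^sup>2\<close> cancels the factor in
    \<open>Xle\<close>.\<close>
  define K where "K = c\<^sup>2 * d powr (a + t)"
  have K: "0 < K" using c d by (simp add: K_def)
  define X where "X = infsum (\<lambda>e. lam e powr (t - 2) * (x \<bullet> e)\<^sup>2) E"
  have X: "((\<lambda>e. lam e powr (t - 2) * (x \<bullet> e)\<^sup>2) has_sum X) E"
    using interpolation(1)[OF d, of "t - 2" h] t by (simp add: X_def x_def)
  have Xle: "X \<le> d powr (t - 2 - a) * (c\<^sup>2 * (norm (A x))\<^sup>2) + d powr (t - 2 + 1) * (x \<bullet> h)"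
    using interpolation(2)[OF d, of "t - 2" h] t by (simp add: X_def x_def)
  have "((\<lambda>e. ?b * ((g \<bullet> e) * (x \<bullet> e))) has_sum ?b * (g \<bullet> x)) E"
    by (intro has_sum_cmult_right Parseval_inner basis_E)
  moreover have "((\<lambda>e. (K * (lam e powr (- t) * (S g \<bullet> e)\<^sup>2) + ?b\<^sup>2 / K * (lam e powr (t - 2) * (x \<bullet> e)\<^sup>2)) / 2)
      has_sum (K * V + ?b\<^sup>2 / K * X) / 2) E"
    by (intro has_sum_divide_const has_sum_add has_sum_cmult_right V X)
  ultimately have "?b * (g \<bullet> x) \<le> (K * V + ?b\<^sup>2 / K * X) / 2"
  proof (rule has_sum_mono)
    fix e assume e: "e \<in> E"
    define l P where "l = lam e" and "P = lam e powr t"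
    have l: "0 < l" using lam_pos[OF e] by (simp add: l_def)
    have P: "0 < P" using l by (simp add: P_def l_def)
    have P1: "lam e powr (- t) = 1 / P" by (simp add: P_def powr_minus divide_inverse)
    have P2: "lam e powr (t - 2) = P / l\<^sup>2" using l by (simp add: P_def l_def powr_diff)
    \<comment> \<open>The weighted Young inequality for one coordinate, as the expansion of a
      square.\<close>
    have "0 \<le> K / P * (l * (g \<bullet> e) - ?b * P * (x \<bullet> e) / (K * l))\<^sup>2" using K P by simp
    also have "\<dots> = K * (1 / P * (l * (g \<bullet> e))\<^sup>2) + ?b\<^sup>2 / K * (P / l\<^sup>2 * (x \<bullet> e)\<^sup>2) - 2 * (?b * ((g \<bullet> e) * (x \<bullet> e)))"
      using K P l by (simp add: power2_diff power_mult_distrib power_divide field_simps) (simp add: power2_eq_square power4_eq_xxxx algebra_simps)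
    finally show "?b * ((g \<bullet> e) * (x \<bullet> e)) \<le>
        (K * (lam e powr (- t) * (S g \<bullet> e)\<^sup>2) + ?b\<^sup>2 / K * (lam e powr (t - 2) * (x \<bullet> e)\<^sup>2)) / 2"
      unfolding P1 P2 S_inner_E[OF e] unfolding l_def[symmetric] by simp
  qed
  also have "?b\<^sup>2 / K * X \<le> (norm (A x))\<^sup>2 + ?b * (x \<bullet> h)"
  proof -
    have b2: "?b\<^sup>2 = d powr (2 * a + 2)" using d by (simp add: power2_eq_square flip: powr_add)
    have bK: "?b\<^sup>2 / K = d powr (2 * a + 2 - (a + t)) / c\<^sup>2" unfolding b2 K_def powr_diff by simp
    have xh: "0 \<le> x \<bullet> h" using S_nonneg by (simp add: x_def)
    have "?b\<^sup>2 / K * X \<le> ?b\<^sup>2 / K * (d powr (t - 2 - a) * (c\<^sup>2 * (norm (A x))\<^sup>2) + d powr (t - 2 + 1) * (x \<bullet> h))"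
      using K by (intro mult_left_mono Xle) auto
    also have "\<dots> = (d powr (2 * a + 2 - (a + t)) * d powr (t - 2 - a)) * (norm (A x))\<^sup>2
        + (d powr (2 * a + 2 - (a + t)) * d powr (t - 2 + 1)) * (x \<bullet> h) / c\<^sup>2"
      unfolding bK using c by (simp add: field_simps)
    also have "\<dots> = (norm (A x))\<^sup>2 + ?b * (x \<bullet> h) / c\<^sup>2"
      using d by (simp flip: powr_add)
    also have "\<dots> \<le> (norm (A x))\<^sup>2 + ?b * (x \<bullet> h)"
      using divide_left_mono[of 1 "c\<^sup>2" "?b * (x \<bullet> h)"] c xh by (simp add: one_le_power)
    finally show ?thesis .
  qed
  also have Q: "(norm (A x))\<^sup>2 + ?b * (x \<bullet> h) = ?b * (g \<bullet> x)"
  proof -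
    have "x \<bullet> (?b *\<^sub>R h + adjoint A (A x)) = x \<bullet> (?b *\<^sub>R g)" using eq by (simp add: x_def)
    then show ?thesis by (simp add: inner_add_right power2_norm_eq_inner A_adjoint inner_commute)
  qed
  \<comment> \<open>The chain reads \<open>Q \<le> (K * V + Q) / 2\<close> with
    \<open>Q = ?b * (g \<bullet> x)\<close>; absorbing \<open>Q\<close> on the left leaves this
    bound.\<close>
  finally have "?b * (g \<bullet> x) \<le> K * V" by (simp add: field_simps)
  then have "c\<^sup>2 * d powr (- a) * ((norm (A x))\<^sup>2 + ?b * (x \<bullet> h)) \<le> c\<^sup>2 * d powr (- a) * (K * V)"
    unfolding Q by (intro mult_left_mono) auto
  also have "\<dots> = c ^ 4 * (d powr (- a) * d powr (a + t)) * V" by (simp add: K_def power4_eq_xxxx power2_eq_square)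
  also have "\<dots> = c ^ 4 * d powr t * V" by (simp flip: powr_add)
  finally show ?thesis using norm_le_energy[OF d, of h] by (simp add: x_def)
qed

theorem bias_bound:
  assumes b: "0 < b" and s: "0 \<le> s" "s \<le> a + 2"
    and R: "bounded_linear R" and eq: "\<And>v. b *\<^sub>R R v + S (adjoint A (A (R v))) = b *\<^sub>R v"
    and W: "((\<lambda>e. lam e powr (- s) * (v \<bullet> e)\<^sup>2) has_sum W) E"
  shows "(norm (R v))\<^sup>2 \<le> 10 * c ^ 4 * W * b powr (s / (a + 1))"
proof -
  interpret R: bounded_linear R by (rule R)
  interpret adj: bounded_linear "adjoint A" by (rule bounded_linear_adjoint[OF A])
  \<comment> \<open>The balance point: \<open>d powr a = b / d\<close>.\<close>
  define d where "d = b powr (1 / (a + 1))"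
  have d: "0 < d" using b by (simp add: d_def)
  have bd: "b = d powr (a + 1)" using b a by (simp add: d_def powr_powr)
  have ds: "d powr s = b powr (s / (a + 1))" by (simp add: d_def powr_powr)
  have W0: "0 \<le> W" by (rule has_sum_nonneg[OF W]) simp
  have c4: "1 \<le> c ^ 4" using c by (rule one_le_power)
  \<comment> \<open>\<open>high_frequency_bound\<close> needs an exponent of at least 1. On
    \<open>F\<close> the eigenvalues are at least \<open>d\<close>, so raising \<open>s\<close> to
    \<open>t\<close> costs a factor \<open>d powr (s - t)\<close>, which later cancels against
    \<open>d powr t\<close>.\<close>
  define t where "t = max s 1"
  have t: "1 \<le> t" "t \<le> a + 2" "s \<le> t" using s a by (auto simp: t_def)
  define F where "F = {e \<in> E. d \<le> lam e}"
  have F: "finite F" "F \<subseteq> E" using finite_large_eigenvalues[OF d] by (auto simp: F_def)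
  define v1 where "v1 = (\<Sum>e\<in>F. (v \<bullet> e) *\<^sub>R e)"
  define v2 where "v2 = v - v1"
  \<comment> \<open>A preimage of \<open>v1\<close> under \<open>S\<close>, available because
    \<open>F\<close> is finite.\<close>
  define g where "g = (\<Sum>e\<in>F. ((v \<bullet> e) / lam e) *\<^sub>R e)"
  have v1e: "v1 \<bullet> e = (if e \<in> F then v \<bullet> e else 0)" if "e \<in> E" for e
    unfolding v1_def by (rule inner_sum_orthonormal[OF orthonormal_E F that])
  have v2e: "v2 \<bullet> e = (if e \<in> F then 0 else v \<bullet> e)" if "e \<in> E" for e
    using v1e[OF that] by (simp add: v2_def inner_diff_left)
  have Sg: "S g = v1"
  proof -
    have "S ((v \<bullet> e / lam e) *\<^sub>R e) = (v \<bullet> e) *\<^sub>R e" if "e \<in> F" for e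
    proof -
      have "e \<in> E" using that F by auto
      then show ?thesis using lam_pos[of e] by (simp add: S.scale S_eigen)
    qed
    then show ?thesis by (simp add: g_def v1_def S.sum)
  qed
  have sol: "R w = w - S (adjoint A ((1 / b) *\<^sub>R A (R w)))" for w
  proof -
    have "(1 / b) *\<^sub>R (b *\<^sub>R R w + S (adjoint A (A (R w)))) = (1 / b) *\<^sub>R (b *\<^sub>R w)" by (simp only: eq)
    then show ?thesis using b by (simp add: scaleR_right_distrib S.scale adj.scale eq_diff_eq)
  qed
  have n1: "(norm (R v1))\<^sup>2 \<le> c ^ 4 * d powr s * W"
  proof -
    \<comment> \<open>A preimage of \<open>R v1\<close> under \<open>S\<close>. With this choice the
      equation without the outer \<open>S\<close> holds by definition, so nothing has to be
      cancelled.\<close>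
    define h where "h = g - adjoint A ((1 / b) *\<^sub>R A (R v1))"
    have Sh: "S h = R v1" using sol[of v1] by (simp add: h_def S.diff Sg)
    have eqh: "d powr (a + 1) *\<^sub>R h + adjoint A (A (S h)) = d powr (a + 1) *\<^sub>R g"
      unfolding bd[symmetric] Sh using b by (simp add: h_def scaleR_right_diff_distrib adj.scale)
    let ?f = "\<lambda>e. lam e powr (- t) * (S g \<bullet> e)\<^sup>2"
    have f: "?f e \<le> d powr (s - t) * (lam e powr (- s) * (v \<bullet> e)\<^sup>2)" if "e \<in> E" for e
    proof (cases "e \<in> F")
      case True
      have "lam e powr (- t) = lam e powr (s - t) * lam e powr (- s)" by (simp flip: powr_add)
      also have "\<dots> \<le> d powr (s - t) * lam e powr (- s)"
        using True d t by (intro mult_right_mono powr_mono2') (auto simp: F_def)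
      finally show ?thesis using True that
        by (simp add: Sg v1e mult.assoc[symmetric] mult_right_mono)
    qed (use that in \<open>simp add: Sg v1e\<close>)
    define V where "V = infsum ?f E"
    have fs: "?f summable_on E" by (rule has_sum_dominated(1)[OF W _ f]) auto
    then have V: "(?f has_sum V) E" by (simp add: V_def)
    have VW: "V \<le> d powr (s - t) * W" unfolding V_def by (rule has_sum_dominated(2)[OF W _ f]) auto
    have "(norm (R v1))\<^sup>2 \<le> c ^ 4 * d powr t * V"
      using high_frequency_bound[OF d t(1,2) eqh V] by (simp add: Sh)
    also have "\<dots> \<le> c ^ 4 * d powr t * (d powr (s - t) * W)"
      using c by (intro mult_left_mono VW) auto
    also have "\<dots> = c ^ 4 * (d powr t * d powr (s - t)) * W" by simp
    also have "\<dots> = c ^ 4 * d powr s * W" by (simp flip: powr_add)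
    finally show ?thesis .
  qed
  have n2: "(norm v2)\<^sup>2 \<le> d powr s * W"
  proof -
    have "(v2 \<bullet> e)\<^sup>2 \<le> d powr s * (lam e powr (- s) * (v \<bullet> e)\<^sup>2)" if "e \<in> E" for e
    proof (cases "e \<in> F")
      case False
      have "1 = lam e powr s * lam e powr (- s)" using lam_pos[OF that] by (simp flip: powr_add)
      also have "\<dots> \<le> d powr s * lam e powr (- s)"
        using False that lam_pos[OF that] s by (intro mult_right_mono powr_mono2) (auto simp: F_def)
      finally show ?thesis using False that mult_right_mono[of 1 "d powr s * lam e powr (- s)" "(v \<bullet> e)\<^sup>2"]
        by (simp add: v2e mult.assoc)
    qed (use that in \<open>simp add: v2e\<close>)
    then have "infsum (\<lambda>e. (v2 \<bullet> e)\<^sup>2) E \<le> d powr s * W"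
      by (intro has_sum_dominated(2)[OF W]) auto
    then show ?thesis using infsumI[OF Parseval[OF basis_E, of v2]] by simp
  qed
  have n3: "(norm (A v2))\<^sup>2 \<le> c\<^sup>2 * (d powr (a + s) * W)"
  proof -
    have "lam e powr a * (v2 \<bullet> e)\<^sup>2 \<le> d powr (a + s) * (lam e powr (- s) * (v \<bullet> e)\<^sup>2)" if "e \<in> E" for e
    proof (cases "e \<in> F")
      case False
      have "lam e powr a = lam e powr (a + s) * lam e powr (- s)" by (simp flip: powr_add)
      also have "\<dots> \<le> d powr (a + s) * lam e powr (- s)"
        using False that lam_pos[OF that] s a by (intro mult_right_mono powr_mono2) (auto simp: F_def)
      finally show ?thesis using False that mult_right_mono[of "lam e powr a" "d powr (a + s) * lam e powr (- s)" "(v \<bullet> e)\<^sup>2"]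
        by (simp add: v2e mult.assoc)
    qed (use that in \<open>simp add: v2e\<close>)
    then have "infsum (\<lambda>e. lam e powr a * (v2 \<bullet> e)\<^sup>2) E \<le> d powr (a + s) * W"
      by (intro has_sum_dominated(2)[OF W]) auto
    then have "(norm (op_powr S (a / 2) v2))\<^sup>2 \<le> d powr (a + s) * W"
      using infsumI[OF op_powr_has_sum[of v2]] by simp
    then have "c\<^sup>2 * (norm (op_powr S (a / 2) v2))\<^sup>2 \<le> c\<^sup>2 * (d powr (a + s) * W)"
      by (intro mult_left_mono) auto
    then show ?thesis using A_le_op_powr[of v2] by linarith
  qed
  have n4: "(norm (v2 - R v2))\<^sup>2 \<le> c ^ 4 * d powr s * W"
  proof -
    let ?q = "(1 / b) *\<^sub>R A (R v2)"
    have z: "v2 - R v2 = S (adjoint A ?q)" using sol[of v2] by (simp add: algebra_simps)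
    have "A (v2 - R v2) + d powr (a + 1) *\<^sub>R ?q = A v2"
      unfolding bd[symmetric] using b by (simp add: A.diff)
    from low_frequency_bound[OF d z this]
    have "(norm (v2 - R v2))\<^sup>2 \<le> c\<^sup>2 * d powr (- a) * (norm (A v2))\<^sup>2" .
    also have "\<dots> \<le> c\<^sup>2 * d powr (- a) * (c\<^sup>2 * (d powr (a + s) * W))"
      by (intro mult_left_mono n3) auto
    also have "\<dots> = c ^ 4 * (d powr (- a) * d powr (a + s)) * W" by (simp add: power4_eq_xxxx power2_eq_square)
    also have "\<dots> = c ^ 4 * d powr s * W" by (simp flip: powr_add)
    finally show ?thesis .
  qed
  have dW: "0 \<le> d powr s * W" using W0 by simp
  then have "d powr s * W \<le> c ^ 4 * d powr s * W"
    using mult_right_mono[OF c4 dW] by (simp add: mult.assoc)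
  moreover have "(norm (R v2))\<^sup>2 \<le> 2 * (norm v2)\<^sup>2 + 2 * (norm (v2 - R v2))\<^sup>2"
    using norm_add_squared_le[of v2 "R v2 - v2"] by (simp add: norm_minus_commute)
  moreover have "R v = R v1 + R v2" by (simp add: v2_def R.diff)
  moreover have "(norm (R v1 + R v2))\<^sup>2 \<le> 2 * (norm (R v1))\<^sup>2 + 2 * (norm (R v2))\<^sup>2"
    by (rule norm_add_squared_le)
  \<comment> \<open>The constant is \<open>10 = 2 * 1 + 2 * (2 + 2)\<close>: one unit from
    \<open>R v1\<close>, and two each from \<open>v2\<close> and \<open>v2 - R v2\<close>.\<close>
  ultimately have "(norm (R v))\<^sup>2 \<le> 10 * (c ^ 4 * d powr s * W)" using n1 n2 n4 by simp
  then show ?thesis by (simp add: ds mult.commute mult.left_commute)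
qed

end

section \<open>The Kalman filter\<close>

lemma positive_selfadjoint_scaleR:
  assumes "positive_selfadjoint S" "0 \<le> r"
  shows "positive_selfadjoint (\<lambda>x. r *\<^sub>R S x)"
proof -
  have "bounded_linear (\<lambda>x. r *\<^sub>R S x)"
    using bounded_linear_compose[OF bounded_linear_scaleR_right positive_selfadjointD(1)[OF assms(1)]] .
  then show ?thesis
    using positive_selfadjointD[OF assms(1)] assms(2) unfolding positive_selfadjoint_def by simp
qed

section \<open>Algebra of a single filter step\<close>

locale kalman_step =
  fixes A :: "'x::{real_inner,banach} \<Rightarrow> 'y::{real_inner,banach}" and \<gamma> :: real and C :: "'x \<Rightarrow> 'x"
  assumes A: "bounded_linear A" and \<gamma>: "0 < \<gamma>" and C: "positive_selfadjoint C"
begin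

sublocale A: bounded_linear A by (rule A)
sublocale adj: bounded_linear "adjoint A" by (rule bounded_linear_adjoint[OF A])
sublocale C: bounded_linear C by (rule positive_selfadjointD[OF C])

lemma C_sym: "C x \<bullet> y = x \<bullet> C y" and C_nonneg: "0 \<le> C x \<bullet> x"
  by (rule positive_selfadjointD[OF C])+

lemma A_adjoint: "A x \<bullet> y = x \<bullet> adjoint A y"
  by (rule adjoint_inner[OF A])

text \<open>The covariance of the innovation, whose inverse occurs in the gain.\<close>

definition G :: "'y \<Rightarrow> 'y" where "G h = A (C (adjoint A h)) + \<gamma>\<^sup>2 *\<^sub>R h"

abbreviation K :: "'y \<Rightarrow> 'x" where "K \<equiv> kalman_gain A \<gamma> C"

text \<open>The adjoint of the gain, as \<open>adjoint_gain\<close> confirms.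
  \<open>is_image\<close> evaluates the noise at adjoint images, so this map selects the test
  vectors.\<close>

definition q :: "'x \<Rightarrow> 'y" where "q x = inv G (A (C x))"

lemma bounded_linear_G: "bounded_linear G"
  unfolding G_def
  by (intro bounded_linear_add bounded_linear_compose[OF A] bounded_linear_compose[OF C.bounded_linear_axioms]
      adj.bounded_linear_axioms bounded_linear_scaleR_right)

lemma G_coercive: "\<gamma>\<^sup>2 * (norm h)\<^sup>2 \<le> G h \<bullet> h"
  using C_nonneg[of "adjoint A h"] by (simp add: G_def inner_add_left A_adjoint power2_norm_eq_inner)

lemma G_inv: "G (inv G y) = y"
  using coercive_bij[OF bounded_linear_G _ G_coercive] \<gamma> by (simp add: bij_is_surj surj_f_inv_f)

lemma bounded_linear_inv_G: "bounded_linear (inv G)"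
  using bounded_linear_inv_coercive[OF bounded_linear_G _ G_coercive] \<gamma> by simp

lemma gain_eq: "K y = C (adjoint A (inv G y))"
  by (simp add: kalman_gain_def G_def[abs_def])

lemma bounded_linear_gain: "bounded_linear K"
  unfolding gain_eq[abs_def]
  by (intro bounded_linear_compose[OF C.bounded_linear_axioms] bounded_linear_compose[OF adj.bounded_linear_axioms]
      bounded_linear_inv_G)

lemma G_sym: "G h \<bullet> k = h \<bullet> G k"
  by (simp add: G_def inner_add_left inner_add_right A_adjoint C_sym)
    (metis A_adjoint inner_commute)

lemma G_q: "G (q x) = A (C x)"
  by (simp add: q_def G_inv)

lemma gain_inner: "K y \<bullet> x = y \<bullet> q x"
proof -
  have "K y \<bullet> x = inv G y \<bullet> A (C x)"
    using A_adjoint[of "C x" "inv G y"] by (simp add: gain_eq C_sym inner_commute)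
  also have "\<dots> = G (inv G y) \<bullet> q x" by (simp add: G_sym G_q)
  finally show ?thesis by (simp add: G_inv)
qed

lemma adjoint_gain: "adjoint K = q"
  by (rule adjoint_unique) (simp add: gain_inner)

text \<open>Since \<open>x - adjoint A (q x)\<close> is the adjoint of \<open>I - K A\<close>
  applied to \<open>x\<close>, the left side is the form of
  \<open>(I - K A) C (I - K A)* + \<gamma>\<^sup>2 K K*\<close>. All correction terms are multiples
  of \<open>G (q x) \<bullet> q x\<close>. Positivity of the updated covariance and the variance
  recursion are read off here.\<close>

lemma Joseph_form:
  "C (x - adjoint A (q x)) \<bullet> (x - adjoint A (q x)) + \<gamma>\<^sup>2 * (norm (q x))\<^sup>2 = (C x - K (A (C x))) \<bullet> x"
proof -
  have "C (adjoint A (q x)) \<bullet> adjoint A (q x) + \<gamma>\<^sup>2 * (norm (q x))\<^sup>2 = G (q x) \<bullet> q x"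
    by (simp add: G_def inner_add_left A_adjoint power2_norm_eq_inner)
  moreover have "C x \<bullet> adjoint A (q x) = G (q x) \<bullet> q x" by (simp add: G_q A_adjoint)
  moreover have "C (adjoint A (q x)) \<bullet> x = C x \<bullet> adjoint A (q x)" by (simp add: C_sym inner_commute)
  ultimately show ?thesis
    by (simp add: C.diff inner_diff_left inner_diff_right gain_inner G_q)
qed

lemma covariance_update:
  shows "positive_selfadjoint (\<lambda>x. C x - K (A (C x)))"
    and "(C x - K (A (C x))) \<bullet> x \<le> C x \<bullet> x"
proof -
  have bl: "bounded_linear (\<lambda>x. C x - K (A (C x)))"
    by (intro bounded_linear_sub C.bounded_linear_axioms bounded_linear_compose[OF bounded_linear_gain]
        bounded_linear_compose[OF A])
  have sym: "(C x - K (A (C x))) \<bullet> y = x \<bullet> (C y - K (A (C y)))" for x y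
  proof -
    have "K (A (C x)) \<bullet> y = G (q x) \<bullet> q y" by (simp add: gain_inner G_q)
    moreover have "x \<bullet> K (A (C y)) = G (q y) \<bullet> q x"
      using gain_inner[of "A (C y)" x] by (simp add: G_q inner_commute)
    moreover have "G (q y) \<bullet> q x = G (q x) \<bullet> q y" by (metis G_sym inner_commute)
    ultimately show ?thesis by (simp add: inner_diff_left inner_diff_right C_sym)
  qed
  have "0 \<le> (C x - K (A (C x))) \<bullet> x" for x
    unfolding Joseph_form[symmetric] using C_nonneg by simp
  with bl sym show "positive_selfadjoint (\<lambda>x. C x - K (A (C x)))"
    unfolding positive_selfadjoint_def by blast
  have "0 \<le> \<gamma>\<^sup>2 * (norm (q x))\<^sup>2" by simp
  also have "\<dots> \<le> G (q x) \<bullet> q x" by (rule G_coercive)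
  finally show "(C x - K (A (C x))) \<bullet> x \<le> C x \<bullet> x"
    by (simp add: inner_diff_left gain_inner G_q)
qed

text \<open>
  The precision form \<open>C\<^sub>n\<^sup>-\<^sup>1 = \<gamma>\<^sup>-\<^sup>2 (\<alpha> S\<^sup>-\<^sup>1 + n A* A)\<close> of the covariance, multiplied by \<open>S\<close> so
  that no inverse occurs.
\<close>

lemma precision_update:
  assumes prec: "\<And>x. \<alpha> *\<^sub>R C x + k *\<^sub>R S (adjoint A (A (C x))) = \<gamma>\<^sup>2 *\<^sub>R S x" and S: "bounded_linear S"
  shows "\<alpha> *\<^sub>R (z - K (A z)) + (k + 1) *\<^sub>R S (adjoint A (A (z - K (A z))))
           = \<alpha> *\<^sub>R z + k *\<^sub>R S (adjoint A (A z))"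
proof -
  interpret S: bounded_linear S by (rule S)
  define w where "w = inv G (A z)"
  have Kw: "K (A z) = C (adjoint A w)" by (simp add: gain_eq w_def)
  \<comment> \<open>\<open>G w = A z\<close> solved for its first summand. The resulting
    \<open>\<gamma>\<^sup>2 *\<^sub>R S (adjoint A w)\<close> cancels against the one from
    \<open>prec\<close> at \<open>adjoint A w\<close>.\<close>
  have "A (K (A z)) = A z - \<gamma>\<^sup>2 *\<^sub>R w"
    using G_inv[of "A z"] by (simp add: G_def Kw eq_diff_eq flip: w_def)
  then have T: "S (adjoint A (A (K (A z)))) = S (adjoint A (A z)) - \<gamma>\<^sup>2 *\<^sub>R S (adjoint A w)"
    by (simp add: adj.diff adj.scale S.diff S.scale)
  have "\<alpha> *\<^sub>R K (A z) = \<gamma>\<^sup>2 *\<^sub>R S (adjoint A w) - k *\<^sub>R S (adjoint A (A (K (A z))))"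
    using prec[of "adjoint A w"] by (simp add: Kw eq_diff_eq)
  then show ?thesis
    by (simp add: A.diff adj.diff S.diff scaleR_right_diff_distrib scaleR_left_distrib T algebra_simps)
qed

end

section \<open>Iterating the filter: covariance and propagation of the error\<close>

fun kalman_error_map ::
    "('x::real_inner \<Rightarrow> 'y::real_inner) \<Rightarrow> real \<Rightarrow> ('x \<Rightarrow> 'x) \<Rightarrow> nat \<Rightarrow> 'x \<Rightarrow> 'x" where
  "kalman_error_map A \<gamma> C 0 v = v"
| "kalman_error_map A \<gamma> C (Suc n) v =
     kalman_error_map A \<gamma> C n v - kalman_gain A \<gamma> (kalman_cov A \<gamma> C n) (A (kalman_error_map A \<gamma> C n v))"

lemma kalman_cov_psa:
  fixes A :: "'x::{real_inner,banach} \<Rightarrow> 'y::{real_inner,banach}"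
  assumes "bounded_linear A" "0 < \<gamma>" "positive_selfadjoint C"
  shows "positive_selfadjoint (kalman_cov A \<gamma> C n)"
proof (induction n)
  case (Suc n)
  then interpret kalman_step A \<gamma> "kalman_cov A \<gamma> C n" using assms by (simp add: kalman_step_def)
  show ?case using covariance_update(1) by simp
qed (simp add: assms)

lemma kalman_step_kalman_cov:
  fixes A :: "'x::{real_inner,banach} \<Rightarrow> 'y::{real_inner,banach}"
  assumes "bounded_linear A" "0 < \<gamma>" "positive_selfadjoint C"
  shows "kalman_step A \<gamma> (kalman_cov A \<gamma> C n)"
  using assms kalman_cov_psa[OF assms] by (simp add: kalman_step_def)

lemma kalman_cov_decreasing:
  fixes A :: "'x::{real_inner,banach} \<Rightarrow> 'y::{real_inner,banach}"
  assumes "bounded_linear A" "0 < \<gamma>" "positive_selfadjoint C"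
  shows "kalman_cov A \<gamma> C n x \<bullet> x \<le> C x \<bullet> x"
proof (induction n)
  case (Suc n)
  interpret kalman_step A \<gamma> "kalman_cov A \<gamma> C n" by (rule kalman_step_kalman_cov[OF assms])
  show ?case using covariance_update(2)[of x] Suc by simp
qed simp

lemma bounded_linear_kalman_error_map:
  fixes A :: "'x::{real_inner,banach} \<Rightarrow> 'y::{real_inner,banach}"
  assumes "bounded_linear A" "0 < \<gamma>" "positive_selfadjoint C"
  shows "bounded_linear (kalman_error_map A \<gamma> C n)"
proof (induction n)
  case 0
  then show ?case by (simp add: bounded_linear_ident)
next
  case (Suc n)
  interpret kalman_step A \<gamma> "kalman_cov A \<gamma> C n" by (rule kalman_step_kalman_cov[OF assms])
  show ?case
    unfolding kalman_error_map.simps(2)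
    by (intro bounded_linear_sub Suc bounded_linear_compose[OF bounded_linear_gain]
        bounded_linear_compose[OF assms(1)])
qed

text \<open>A conservation law: \<open>C n x\<close> evolves by \<open>z - K (A z)\<close>, and
  \<open>precision_update\<close> says that \<open>\<alpha> z + n S A* A z\<close> keeps its value
  along such a step. The value at \<open>n = 0\<close> is the right-hand side.\<close>

lemma kalman_precision:
  fixes A :: "'x::{real_inner,banach} \<Rightarrow> 'y::{real_inner,banach}"
  assumes A: "bounded_linear A" and \<gamma>: "0 < \<gamma>" and \<alpha>: "0 < \<alpha>" and S: "positive_selfadjoint S"
  defines "C \<equiv> kalman_cov A \<gamma> (\<lambda>x. (\<gamma>\<^sup>2 / \<alpha>) *\<^sub>R S x)"
  shows "\<alpha> *\<^sub>R C n x + real n *\<^sub>R S (adjoint A (A (C n x))) = \<gamma>\<^sup>2 *\<^sub>R S x"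
proof (induction n arbitrary: x)
  case 0
  then show ?case using \<alpha> by (simp add: C_def)
next
  case (Suc n)
  have C0: "positive_selfadjoint (\<lambda>x. (\<gamma>\<^sup>2 / \<alpha>) *\<^sub>R S x)" using S \<alpha> by (intro positive_selfadjoint_scaleR) auto
  interpret kalman_step A \<gamma> "C n" unfolding C_def by (rule kalman_step_kalman_cov[OF A \<gamma> C0])
  have "C (Suc n) x = C n x - K (A (C n x))" by (simp add: C_def)
  then show ?case
    using precision_update[OF Suc positive_selfadjointD(1)[OF S], of "C n x"] Suc[of x]
    by (simp add: add.commute)
qed

text \<open>The error follows the same recursion as the columns of the covariance, so the same
  quantity is conserved, now started at \<open>v\<close>.\<close>

lemma kalman_error_map_equation:
  fixes A :: "'x::{real_inner,banach} \<Rightarrow> 'y::{real_inner,banach}"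
  assumes A: "bounded_linear A" and \<gamma>: "0 < \<gamma>" and \<alpha>: "0 < \<alpha>" and S: "positive_selfadjoint S"
  defines "R \<equiv> kalman_error_map A \<gamma> (\<lambda>x. (\<gamma>\<^sup>2 / \<alpha>) *\<^sub>R S x)"
  shows "\<alpha> *\<^sub>R R n v + real n *\<^sub>R S (adjoint A (A (R n v))) = \<alpha> *\<^sub>R v"
proof (induction n)
  case 0
  then show ?case by (simp add: R_def)
next
  case (Suc n)
  let ?C = "kalman_cov A \<gamma> (\<lambda>x. (\<gamma>\<^sup>2 / \<alpha>) *\<^sub>R S x)"
  have C0: "positive_selfadjoint (\<lambda>x. (\<gamma>\<^sup>2 / \<alpha>) *\<^sub>R S x)" using S \<alpha> by (intro positive_selfadjoint_scaleR) auto
  interpret kalman_step A \<gamma> "?C n" by (rule kalman_step_kalman_cov[OF A \<gamma> C0])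
  have "R (Suc n) v = R n v - K (A (R n v))" by (simp add: R_def)
  then show ?case
    using precision_update[OF kalman_precision[OF A \<gamma> \<alpha> S] positive_selfadjointD(1)[OF S], of "R n v"] Suc
    by (simp add: add.commute)
qed

section \<open>Second moments of the noise and of the filter error\<close>

lemma white_noise_moments:
  assumes "prob_space M" and wn: "gaussian_white_noise M \<gamma> \<zeta>" and \<gamma>: "0 < \<gamma>"
  shows "integrable M (\<zeta> h)" "integrable M (\<lambda>\<omega>. (\<zeta> h \<omega>)\<^sup>2)"
    and "(\<integral>\<omega>. \<zeta> h \<omega> \<partial>M) = 0" "(\<integral>\<omega>. (\<zeta> h \<omega>)\<^sup>2 \<partial>M) = \<gamma>\<^sup>2 * (norm h)\<^sup>2"
proof -
  interpret prob_space M by fact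
  have meas[measurable]: "\<zeta> h \<in> borel_measurable M" using wn by (simp add: gaussian_white_noise_def)
  have "integrable M (\<zeta> h) \<and> integrable M (\<lambda>\<omega>. (\<zeta> h \<omega>)\<^sup>2) \<and> (\<integral>\<omega>. \<zeta> h \<omega> \<partial>M) = 0 \<and>
    (\<integral>\<omega>. (\<zeta> h \<omega>)\<^sup>2 \<partial>M) = \<gamma>\<^sup>2 * (norm h)\<^sup>2"
  proof (cases "h = 0")
    case True
    \<comment> \<open>The law is prescribed for nonzero vectors only; at zero, linearity with two
      zero coefficients makes the variable vanish almost surely.\<close>
    have "AE \<omega> in M. \<zeta> (0 *\<^sub>R h + 0 *\<^sub>R h) \<omega> = 0 * \<zeta> h \<omega> + 0 * \<zeta> h \<omega>"
      using wn unfolding gaussian_white_noise_def by blast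
    then have z: "AE \<omega> in M. \<zeta> h \<omega> = 0" by (simp add: True)
    have "integrable M (\<zeta> h)" using z by (subst integrable_cong_AE[where g = "\<lambda>_. 0"]) auto
    moreover have "integrable M (\<lambda>\<omega>. (\<zeta> h \<omega>)\<^sup>2)" using z by (subst integrable_cong_AE[where g = "\<lambda>_. 0"]) auto
    moreover have "(\<integral>\<omega>. \<zeta> h \<omega> \<partial>M) = 0" using z by (subst integral_cong_AE[where g = "\<lambda>_. 0"]) auto
    moreover have "(\<integral>\<omega>. (\<zeta> h \<omega>)\<^sup>2 \<partial>M) = 0" using z by (subst integral_cong_AE[where g = "\<lambda>_. 0"]) auto
    ultimately show ?thesis using True by simp
  next
    case False
    let ?s = "\<gamma> * norm h"
    have s: "0 < ?s" using False \<gamma> by simp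
    have D: "distributed M lborel (\<zeta> h) (normal_density 0 ?s)"
      using wn False by (simp add: gaussian_white_noise_def)
    have "integrable M (\<lambda>\<omega>. (\<zeta> h \<omega>) ^ k)" for k
      using integrable_normal_moment[OF s, of 0 k] distributed_integrable[OF D, of "\<lambda>x. x ^ k"] by simp
    from this[of 1] this[of 2] have i: "integrable M (\<zeta> h)" "integrable M (\<lambda>\<omega>. (\<zeta> h \<omega>)\<^sup>2)" by simp_all
    have e: "expectation (\<zeta> h) = 0" by (rule normal_distributed_expectation[OF s D])
    have "expectation (\<lambda>\<omega>. (\<zeta> h \<omega>)\<^sup>2) = ?s\<^sup>2"
      using normal_distributed_variance[OF s D] by (simp add: e)
    with i e show ?thesis by (simp add: power_mult_distrib)
  qed
  then show "integrable M (\<zeta> h)" "integrable M (\<lambda>\<omega>. (\<zeta> h \<omega>)\<^sup>2)"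
    "(\<integral>\<omega>. \<zeta> h \<omega> \<partial>M) = 0" "(\<integral>\<omega>. (\<zeta> h \<omega>)\<^sup>2 \<partial>M) = \<gamma>\<^sup>2 * (norm h)\<^sup>2" by blast+
qed

lemma iid_white_noise_product:
  assumes "prob_space M" and wn: "iid_white_noise M \<gamma> \<eta>" and \<gamma>: "0 < \<gamma>" and "1 \<le> i" "1 \<le> j"
  shows "integrable M (\<lambda>\<omega>. \<eta> i (h i) \<omega> * \<eta> j (h j) \<omega>)"
    and "(\<integral>\<omega>. \<eta> i (h i) \<omega> * \<eta> j (h j) \<omega> \<partial>M) = (if i = j then \<gamma>\<^sup>2 * (norm (h i))\<^sup>2 else 0)"
proof -
  interpret prob_space M by fact
  have g: "gaussian_white_noise M \<gamma> (\<eta> k)" if "1 \<le> k" for k using wn that by (simp add: iid_white_noise_def)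
  note mom = white_noise_moments[OF \<open>prob_space M\<close> g \<gamma>]
  have "integrable M (\<lambda>\<omega>. \<eta> i (h i) \<omega> * \<eta> j (h j) \<omega>) \<and>
    (\<integral>\<omega>. \<eta> i (h i) \<omega> * \<eta> j (h j) \<omega> \<partial>M) = (if i = j then \<gamma>\<^sup>2 * (norm (h i))\<^sup>2 else 0)"
  proof (cases "i = j")
    case True
    then show ?thesis using mom(2,4)[OF \<open>1 \<le> i\<close>, of "h i"] by (simp add: power2_eq_square)
  next
    case False
    have "indep_vars (\<lambda>_. PiM UNIV (\<lambda>_. borel)) (\<lambda>n \<omega> h. \<eta> n h \<omega>) {1..}"
      using wn by (simp add: iid_white_noise_def)
    \<comment> \<open>Independence of the whole noise families passes to one coordinate of each,
      since evaluation at \<open>h n\<close> is measurable on the product space.\<close>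
    then have "indep_vars (\<lambda>_. borel) (\<lambda>n \<omega>. (\<lambda>f. f (h n)) (\<lambda>h. \<eta> n h \<omega>)) {1..}"
      by (rule indep_vars_compose2) (rule measurable_component_singleton, simp)
    then have ind: "indep_vars (\<lambda>_. borel) (\<lambda>n. \<eta> n (h n)) {i, j}"
      using assms(4,5) by (intro indep_vars_subset[where J = "{i, j}"]) auto
    have int: "integrable M (\<eta> k (h k))" if "k \<in> {i, j}" for k using mom(1) assms(4,5) that by auto
    show ?thesis
      using indep_vars_integrable[OF _ ind int] indep_vars_lebesgue_integral[OF _ ind int] False mom(3)[OF assms(4)]
      by simp
  qed
  then show "integrable M (\<lambda>\<omega>. \<eta> i (h i) \<omega> * \<eta> j (h j) \<omega>)"
    "(\<integral>\<omega>. \<eta> i (h i) \<omega> * \<eta> j (h j) \<omega> \<partial>M) = (if i = j then \<gamma>\<^sup>2 * (norm (h i))\<^sup>2 else 0)" by blast+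
qed

lemma shifted_noise_second_moment:
  assumes ps: "prob_space M" and wn: "iid_white_noise M \<gamma> \<eta>" and \<gamma>: "0 < \<gamma>"
  shows "integrable M (\<lambda>\<omega>. (b + (\<Sum>j\<in>{1..n}. \<eta> j (h j) \<omega>))\<^sup>2)"
    and "(\<integral>\<omega>. (b + (\<Sum>j\<in>{1..n}. \<eta> j (h j) \<omega>))\<^sup>2 \<partial>M) = b\<^sup>2 + \<gamma>\<^sup>2 * (\<Sum>j\<in>{1..n}. (norm (h j))\<^sup>2)"
proof -
  interpret prob_space M by fact
  have g: "gaussian_white_noise M \<gamma> (\<eta> k)" if "1 \<le> k" for k using wn that by (simp add: iid_white_noise_def)
  note mom = white_noise_moments[OF ps g \<gamma>]
  note pr = iid_white_noise_product[OF ps wn \<gamma>]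
  have eq: "(b + (\<Sum>j\<in>{1..n}. \<eta> j (h j) \<omega>))\<^sup>2 = b\<^sup>2 + (2 * b) * (\<Sum>j\<in>{1..n}. \<eta> j (h j) \<omega>)
      + (\<Sum>i\<in>{1..n}. \<Sum>j\<in>{1..n}. \<eta> i (h i) \<omega> * \<eta> j (h j) \<omega>)" for \<omega>
    unfolding power2_sum unfolding power2_eq_square[of "sum _ _"] sum_product by (simp only: ac_simps)
  have i1: "integrable M (\<lambda>\<omega>. \<Sum>j\<in>{1..n}. \<eta> j (h j) \<omega>)"
    by (intro Bochner_Integration.integrable_sum mom(1)) auto
  have i2: "integrable M (\<lambda>\<omega>. \<Sum>i\<in>{1..n}. \<Sum>j\<in>{1..n}. \<eta> i (h i) \<omega> * \<eta> j (h j) \<omega>)"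
    by (intro Bochner_Integration.integrable_sum pr(1)) auto
  show "integrable M (\<lambda>\<omega>. (b + (\<Sum>j\<in>{1..n}. \<eta> j (h j) \<omega>))\<^sup>2)"
    unfolding eq using i1 i2 by auto
  have "(\<integral>\<omega>. (\<Sum>j\<in>{1..n}. \<eta> j (h j) \<omega>) \<partial>M) = 0"
    using mom(1,3) by (subst Bochner_Integration.integral_sum) auto
  moreover have "(\<integral>\<omega>. (\<Sum>i\<in>{1..n}. \<Sum>j\<in>{1..n}. \<eta> i (h i) \<omega> * \<eta> j (h j) \<omega>) \<partial>M)
      = (\<Sum>i\<in>{1..n}. \<Sum>j\<in>{1..n}. \<integral>\<omega>. \<eta> i (h i) \<omega> * \<eta> j (h j) \<omega> \<partial>M)"
  proof -
    have "(\<integral>\<omega>. (\<Sum>i\<in>{1..n}. \<Sum>j\<in>{1..n}. \<eta> i (h i) \<omega> * \<eta> j (h j) \<omega>) \<partial>M)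
        = (\<Sum>i\<in>{1..n}. \<integral>\<omega>. (\<Sum>j\<in>{1..n}. \<eta> i (h i) \<omega> * \<eta> j (h j) \<omega>) \<partial>M)"
      by (intro Bochner_Integration.integral_sum Bochner_Integration.integrable_sum pr(1)) auto
    also have "\<dots> = (\<Sum>i\<in>{1..n}. \<Sum>j\<in>{1..n}. \<integral>\<omega>. \<eta> i (h i) \<omega> * \<eta> j (h j) \<omega> \<partial>M)"
      by (intro sum.cong refl Bochner_Integration.integral_sum pr(1)) auto
    finally show ?thesis .
  qed
  moreover have "\<dots> = (\<Sum>i\<in>{1..n}. \<Sum>j\<in>{1..n}. if i = j then \<gamma>\<^sup>2 * (norm (h i))\<^sup>2 else 0)"
    using pr(2) by (intro sum.cong refl) auto
  moreover have "\<dots> = \<gamma>\<^sup>2 * (\<Sum>j\<in>{1..n}. (norm (h j))\<^sup>2)" by (simp add: sum_distrib_left)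
  ultimately show "(\<integral>\<omega>. (b + (\<Sum>j\<in>{1..n}. \<eta> j (h j) \<omega>))\<^sup>2 \<partial>M) = b\<^sup>2 + \<gamma>\<^sup>2 * (\<Sum>j\<in>{1..n}. (norm (h j))\<^sup>2)"
    unfolding eq using i1 i2 by (simp add: prob_space)
qed

text \<open>The recursion is transposed onto the test vector: the error after step
  \<open>n + 1\<close> paired with \<open>x\<close> is the error after step \<open>n\<close> paired
  with \<open>x - adjoint A (q x)\<close>, plus the new noise at \<open>q x\<close>. Hence
  \<open>x\<close> stays arbitrary in the induction, and the noise vectors \<open>h\<close> depend
  on it. \<open>Joseph_form\<close> is exactly the matching recursion for the variances.\<close>

lemma kalman_error_representation:
  fixes A :: "'x::{real_inner,banach} \<Rightarrow> 'y::{real_inner,banach}"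
  assumes A: "bounded_linear A" and \<gamma>: "0 < \<gamma>" and C: "positive_selfadjoint C"
    and y: "\<And>n h \<omega>. 1 \<le> n \<Longrightarrow> y n h \<omega> = A u \<bullet> h + \<eta> n h \<omega>"
    and m: "kalman_mean M A \<gamma> C m\<^sub>0 y m"
  shows "\<exists>h. (AE \<omega> in M. (m n \<omega> - u) \<bullet> x = kalman_error_map A \<gamma> C n (m\<^sub>0 - u) \<bullet> x + (\<Sum>j\<in>{1..n}. \<eta> j (h j) \<omega>)) \<and>
    \<gamma>\<^sup>2 * (\<Sum>j\<in>{1..n}. (norm (h j))\<^sup>2) \<le> kalman_cov A \<gamma> C n x \<bullet> x"
proof (induction n arbitrary: x)
  case 0
  have "AE \<omega> in M. (m 0 \<omega> - u) \<bullet> x = (m\<^sub>0 - u) \<bullet> x"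
    using m by (intro AE_I2) (simp add: kalman_mean_def)
  then show ?case using positive_selfadjointD(3)[OF C] by simp
next
  case (Suc n)
  interpret kalman_step A \<gamma> "kalman_cov A \<gamma> C n" by (rule kalman_step_kalman_cov[OF A \<gamma> C])
  let ?R = "\<lambda>n. kalman_error_map A \<gamma> C n (m\<^sub>0 - u)"
  let ?x = "x - adjoint A (q x)"
  obtain h where h: "AE \<omega> in M. (m n \<omega> - u) \<bullet> ?x = ?R n \<bullet> ?x + (\<Sum>j\<in>{1..n}. \<eta> j (h j) \<omega>)"
    and hC: "\<gamma>\<^sup>2 * (\<Sum>j\<in>{1..n}. (norm (h j))\<^sup>2) \<le> kalman_cov A \<gamma> C n ?x \<bullet> ?x"
    using Suc by blast
  define h' where "h' = h(Suc n := q x)"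
  have s: "(\<Sum>j\<in>{1..Suc n}. f j (h' j)) = (\<Sum>j\<in>{1..n}. f j (h j)) + f (Suc n) (q x)" for f :: "nat \<Rightarrow> 'y \<Rightarrow> real"
  proof -
    have "(\<Sum>j\<in>{1..n}. f j (h' j)) = (\<Sum>j\<in>{1..n}. f j (h j))"
      by (intro sum.cong) (auto simp: h'_def)
    then show ?thesis by (simp add: h'_def)
  qed
  have R: "?R (Suc n) \<bullet> x = ?R n \<bullet> ?x"
    by (simp add: inner_diff_left inner_diff_right gain_inner A_adjoint)
  have "AE \<omega> in M. (m (Suc n) \<omega> - m n \<omega>) \<bullet> x = y (Suc n) (q x) \<omega> - A (m n \<omega>) \<bullet> q x"
  proof -
    have "\<forall>n\<ge>1. is_image M (kalman_gain A \<gamma> (kalman_cov A \<gamma> C (n - 1)))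
        (\<lambda>h \<omega>. y n h \<omega> - A (m (n - 1) \<omega>) \<bullet> h) (\<lambda>\<omega>. m n \<omega> - m (n - 1) \<omega>)"
      using m unfolding kalman_mean_def by blast
    then have "is_image M K (\<lambda>h \<omega>. y (Suc n) h \<omega> - A (m n \<omega>) \<bullet> h) (\<lambda>\<omega>. m (Suc n) \<omega> - m n \<omega>)"
      by (auto dest: spec[of _ "Suc n"])
    then show ?thesis by (simp add: is_image_def adjoint_gain)
  qed
  with h have "AE \<omega> in M. (m (Suc n) \<omega> - u) \<bullet> x = ?R (Suc n) \<bullet> x + (\<Sum>j\<in>{1..Suc n}. \<eta> j (h' j) \<omega>)"
  proof eventually_elim
    case (elim \<omega>)
    have "(m (Suc n) \<omega> - u) \<bullet> x = (m n \<omega> - u) \<bullet> ?x + \<eta> (Suc n) (q x) \<omega>"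
      using elim(2) y[of "Suc n" "q x" \<omega>] by (simp add: inner_diff_left inner_diff_right A_adjoint)
    then show ?case using elim(1) R s[of "\<lambda>j k. \<eta> j k \<omega>"] by simp
  qed
  moreover have "\<gamma>\<^sup>2 * (\<Sum>j\<in>{1..Suc n}. (norm (h' j))\<^sup>2) \<le> kalman_cov A \<gamma> C (Suc n) x \<bullet> x"
    using hC Joseph_form[of x] s[of "\<lambda>_ k. (norm k)\<^sup>2"] by (simp add: distrib_left)
  ultimately show ?case by blast
qed

text \<open>Passes from the net of finite subsets to a sequence, as monotone convergence of
  integrals requires.\<close>

lemma has_sum_LIMSEQ_exhaustion:
  assumes "(f has_sum x) B" and F: "incseq F" "\<And>n. finite (F n)" "(\<Union>n. F n) = B"
  shows "(\<lambda>n::nat. sum f (F n)) \<longlonglongrightarrow> x"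
proof (rule filterlim_compose[of "sum f"])
  show "(sum f \<longlongrightarrow> x) (finite_subsets_at_top B)" using assms(1) by (simp add: has_sum_def)
  show "filterlim F (finite_subsets_at_top B) sequentially"
    unfolding filterlim_finite_subsets_at_top
  proof (intro allI impI)
    fix X assume X: "finite X \<and> X \<subseteq> B"
    then have "finite X" "X \<subseteq> (\<Union>n. F n)" using F(3) by auto
    then obtain N where N: "X \<subseteq> F N"
    proof (induction X arbitrary: thesis)
      case (insert z X)
      obtain N where N: "X \<subseteq> F N" using insert by auto
      obtain k where k: "z \<in> F k" using insert.prems by auto
      have "insert z X \<subseteq> F (max N k)" using N k incseqD[OF F(1)] by (meson insert_subset max.cobounded1 max.cobounded2 subset_iff)
      then show ?case by (rule insert.prems(1))
    qed auto
    show "\<forall>\<^sub>F n in sequentially. finite (F n) \<and> X \<subseteq> F n \<and> F n \<subseteq> B"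
      using eventually_ge_at_top[of N]
    proof eventually_elim
      case (elim n)
      then show ?case using N incseqD[OF F(1), of N n] F(2,3) by blast
    qed
  qed
qed

text \<open>Parseval and monotone convergence along an enumeration of the basis. Working with
  nonnegative integrals yields integrability together with the bound.\<close>

lemma mean_square_le_coordinates:
  fixes Z :: "'w \<Rightarrow> 'x::real_inner"
  assumes Z[measurable]: "Z \<in> borel_measurable M" and B: "orthonormal_basis B" "countable B" and K: "0 \<le> K"
    and i: "\<And>e. e \<in> B \<Longrightarrow> integrable M (\<lambda>\<omega>. (Z \<omega> \<bullet> e)\<^sup>2)"
    and bd: "\<And>F. finite F \<Longrightarrow> F \<subseteq> B \<Longrightarrow> (\<Sum>e\<in>F. \<integral>\<omega>. (Z \<omega> \<bullet> e)\<^sup>2 \<partial>M) \<le> K"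
  shows "mean_square_le M Z K"
proof -
  define F where "F n = {e \<in> B. to_nat_on B e < n}" for n
  have F: "incseq F" "(\<Union>n. F n) = B" by (auto simp: F_def incseq_def)
  have "finite (F n)" for n
  proof (rule finite_imageD)
    show "inj_on (to_nat_on B) (F n)" using B(2) inj_on_to_nat_on by (auto simp: F_def intro: inj_on_subset)
    show "finite (to_nat_on B ` F n)" by (rule finite_subset[of _ "{..<n}"]) (auto simp: F_def)
  qed
  note F = F this
  have FB: "F n \<subseteq> B" for n by (auto simp: F_def)
  have lim: "(\<lambda>n. \<Sum>e\<in>F n. (Z \<omega> \<bullet> e)\<^sup>2) \<longlonglongrightarrow> (norm (Z \<omega>))\<^sup>2" for \<omega>
    by (rule has_sum_LIMSEQ_exhaustion[OF Parseval[OF B(1)] F(1,3,2)])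
  have mono: "(\<Sum>e\<in>F m. (Z \<omega> \<bullet> e)\<^sup>2) \<le> (\<Sum>e\<in>F n. (Z \<omega> \<bullet> e)\<^sup>2)" if "m \<le> n" for m n \<omega>
    using incseqD[OF F(1) that] F(3) by (intro sum_mono2) auto
  have si: "integrable M (\<lambda>\<omega>. \<Sum>e\<in>F n. (Z \<omega> \<bullet> e)\<^sup>2)" for n
    using i FB by (intro Bochner_Integration.integrable_sum) auto
  have nm: "(\<lambda>\<omega>. (norm (Z \<omega>))\<^sup>2) \<in> borel_measurable M"
    by (rule borel_measurable_LIMSEQ_real[OF lim]) (rule borel_measurable_integrable[OF si])
  have "(\<integral>\<^sup>+\<omega>. ennreal ((norm (Z \<omega>))\<^sup>2) \<partial>M) = (\<integral>\<^sup>+\<omega>. (SUP n. ennreal (\<Sum>e\<in>F n. (Z \<omega> \<bullet> e)\<^sup>2)) \<partial>M)"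
  proof (rule nn_integral_cong)
    fix \<omega>
    have "(\<lambda>n. ennreal (\<Sum>e\<in>F n. (Z \<omega> \<bullet> e)\<^sup>2)) \<longlonglongrightarrow> (SUP n. ennreal (\<Sum>e\<in>F n. (Z \<omega> \<bullet> e)\<^sup>2))"
      by (intro LIMSEQ_SUP) (auto simp: incseq_def intro!: ennreal_leI mono)
    moreover have "(\<lambda>n. ennreal (\<Sum>e\<in>F n. (Z \<omega> \<bullet> e)\<^sup>2)) \<longlonglongrightarrow> ennreal ((norm (Z \<omega>))\<^sup>2)"
      by (intro tendsto_ennrealI lim)
    ultimately show "ennreal ((norm (Z \<omega>))\<^sup>2) = (SUP n. ennreal (\<Sum>e\<in>F n. (Z \<omega> \<bullet> e)\<^sup>2))"
      by (rule LIMSEQ_unique[rotated])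
  qed
  also have "\<dots> = (SUP n. \<integral>\<^sup>+\<omega>. ennreal (\<Sum>e\<in>F n. (Z \<omega> \<bullet> e)\<^sup>2) \<partial>M)"
    using borel_measurable_integrable[OF si]
    by (intro nn_integral_monotone_convergence_SUP) (auto simp: incseq_def le_fun_def intro!: ennreal_leI mono)
  also have "\<dots> \<le> ennreal K"
  proof (rule SUP_least)
    fix n
    have "(\<integral>\<^sup>+\<omega>. ennreal (\<Sum>e\<in>F n. (Z \<omega> \<bullet> e)\<^sup>2) \<partial>M) = ennreal (\<integral>\<omega>. (\<Sum>e\<in>F n. (Z \<omega> \<bullet> e)\<^sup>2) \<partial>M)"
      by (intro nn_integral_eq_integral si) (simp add: sum_nonneg)
    also have "(\<integral>\<omega>. (\<Sum>e\<in>F n. (Z \<omega> \<bullet> e)\<^sup>2) \<partial>M) = (\<Sum>e\<in>F n. \<integral>\<omega>. (Z \<omega> \<bullet> e)\<^sup>2 \<partial>M)"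
      using i FB by (intro Bochner_Integration.integral_sum) auto
    also have "ennreal \<dots> \<le> ennreal K" by (intro ennreal_leI bd F(3) FB)
    finally show "(\<integral>\<^sup>+\<omega>. ennreal (\<Sum>e\<in>F n. (Z \<omega> \<bullet> e)\<^sup>2) \<partial>M) \<le> ennreal K" .
  qed
  finally have nn: "(\<integral>\<^sup>+\<omega>. ennreal ((norm (Z \<omega>))\<^sup>2) \<partial>M) \<le> ennreal K" .
  have int: "integrable M (\<lambda>\<omega>. (norm (Z \<omega>))\<^sup>2)"
    using nm nn by (intro integrableI_bounded) (auto simp: le_less_trans ennreal_less_top top.not_eq_extremum)
  have "ennreal (\<integral>\<omega>. (norm (Z \<omega>))\<^sup>2 \<partial>M) \<le> ennreal K"
    using nn nn_integral_eq_integral[OF int] by simp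
  then have "(\<integral>\<omega>. (norm (Z \<omega>))\<^sup>2 \<partial>M) \<le> K" using K by (simp add: ennreal_le_iff)
  with int show ?thesis by (simp add: mean_square_le_def)
qed

text \<open>A summable real family has countably many nonzero members, and by injectivity every
  basis vector gives a nonzero one.\<close>

lemma (in injective_trace_class) countable_orthonormal_basis:
  fixes B :: "'x set"
  assumes "orthonormal_basis B"
  shows "countable B"
proof -
  have "countable {e \<in> B. S e \<bullet> e \<noteq> 0}"
    using summable_trace[OF assms] by (rule summable_countable_real)
  also have "{e \<in> B. S e \<bullet> e \<noteq> 0} = B"
  proof -
    have "S e \<bullet> e \<noteq> 0" if "e \<in> B" for e
    proof -
      have "e \<noteq> 0" using assms that by (auto simp: orthonormal_basis_def)
      then show ?thesis using injective_positive_definite[OF psa inj, of e] by simp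
    qed
    then show ?thesis by blast
  qed
  finally show ?thesis .
qed

lemma (in injective_trace_class) trace_bound:
  assumes "finite F" "F \<subseteq> (SOME B. orthonormal_basis B)"
  shows "(\<Sum>e\<in>F. S e \<bullet> e) \<le> op_trace S"
proof -
  have "orthonormal_basis (SOME B :: 'x set. orthonormal_basis B)" by (rule someI[of orthonormal_basis, OF basis_E])
  then show ?thesis unfolding op_trace_def
    using assms S_nonneg by (intro finite_sum_le_infsum summable_trace) auto
qed

lemma (in injective_trace_class) kalman_mean_square_error:
  fixes A :: "'x \<Rightarrow> 'y::{real_inner,banach}"
  assumes A: "bounded_linear A" and \<gamma>: "0 < \<gamma>" and \<alpha>: "0 < \<alpha>" and y: "data_model_1 M A u \<gamma> y"
    and m: "kalman_mean M A \<gamma> (\<lambda>x. (\<gamma>\<^sup>2 / \<alpha>) *\<^sub>R S x) m\<^sub>0 y m"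
    and bias: "(norm (kalman_error_map A \<gamma> (\<lambda>x. (\<gamma>\<^sup>2 / \<alpha>) *\<^sub>R S x) n (m\<^sub>0 - u)))\<^sup>2 \<le> b"
  shows "mean_square_le M (\<lambda>\<omega>. m n \<omega> - u) (b + \<gamma>\<^sup>2 / \<alpha> * op_trace S)"
proof -
  let ?C = "\<lambda>x. (\<gamma>\<^sup>2 / \<alpha>) *\<^sub>R S x"
  let ?R = "kalman_error_map A \<gamma> ?C n (m\<^sub>0 - u)"
  let ?Z = "\<lambda>\<omega>. m n \<omega> - u"
  have ps: "prob_space M" using y by (simp add: data_model_1_def)
  obtain \<eta> where wn: "iid_white_noise M \<gamma> \<eta>" and y\<eta>: "\<And>n h \<omega>. 1 \<le> n \<Longrightarrow> y n h \<omega> = A u \<bullet> h + \<eta> n h \<omega>"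
    using y unfolding data_model_1_def by blast
  have C: "positive_selfadjoint ?C" using psa \<alpha> by (intro positive_selfadjoint_scaleR) auto
  \<comment> \<open>The basis selected in \<open>op_trace\<close>, so that partial sums of the
    variances compare directly with its value.\<close>
  define B where "B = (SOME B :: 'x set. orthonormal_basis B)"
  have B: "orthonormal_basis B" unfolding B_def by (rule someI[of orthonormal_basis, OF basis_E])
  have mn: "m n \<in> borel_measurable M" using m by (simp add: kalman_mean_def)
  have Zm: "?Z \<in> borel_measurable M"
    by (rule measurable_compose[OF mn borel_measurable_continuous_onI]) (intro continuous_intros)
  have e: "integrable M (\<lambda>\<omega>. (?Z \<omega> \<bullet> x)\<^sup>2) \<and> (\<integral>\<omega>. (?Z \<omega> \<bullet> x)\<^sup>2 \<partial>M) \<le> (?R \<bullet> x)\<^sup>2 + ?C x \<bullet> x" for x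
  proof -
    obtain h where h: "AE \<omega> in M. ?Z \<omega> \<bullet> x = ?R \<bullet> x + (\<Sum>j\<in>{1..n}. \<eta> j (h j) \<omega>)"
      and hC: "\<gamma>\<^sup>2 * (\<Sum>j\<in>{1..n}. (norm (h j))\<^sup>2) \<le> kalman_cov A \<gamma> ?C n x \<bullet> x"
      using kalman_error_representation[OF A \<gamma> C y\<eta> m] by blast
    have h2: "AE \<omega> in M. (?Z \<omega> \<bullet> x)\<^sup>2 = (?R \<bullet> x + (\<Sum>j\<in>{1..n}. \<eta> j (h j) \<omega>))\<^sup>2"
      using h by eventually_elim simp
    note sm = shifted_noise_second_moment[OF ps wn \<gamma>, where b = "?R \<bullet> x" and n = n and h = h]
    have Zx: "(\<lambda>\<omega>. (?Z \<omega> \<bullet> x)\<^sup>2) \<in> borel_measurable M"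
      by (rule measurable_compose[OF Zm borel_measurable_continuous_onI]) (intro continuous_intros)
    have "integrable M (\<lambda>\<omega>. (?Z \<omega> \<bullet> x)\<^sup>2)"
      using sm(1) integrable_cong_AE[OF Zx borel_measurable_integrable[OF sm(1)] h2] by blast
    moreover have "(\<integral>\<omega>. (?Z \<omega> \<bullet> x)\<^sup>2 \<partial>M) \<le> (?R \<bullet> x)\<^sup>2 + ?C x \<bullet> x"
      using sm(2) integral_cong_AE[OF Zx borel_measurable_integrable[OF sm(1)] h2] hC
        kalman_cov_decreasing[OF A \<gamma> C, of n x] by linarith
    ultimately show ?thesis by blast
  qed
  have ga: "0 \<le> \<gamma>\<^sup>2 / \<alpha>" using \<alpha> by simp
  have fin: "(\<Sum>e\<in>F. \<integral>\<omega>. (?Z \<omega> \<bullet> e)\<^sup>2 \<partial>M) \<le> b + \<gamma>\<^sup>2 / \<alpha> * op_trace S" if F: "finite F" "F \<subseteq> B" for F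
  proof -
    have "(\<Sum>e\<in>F. \<integral>\<omega>. (?Z \<omega> \<bullet> e)\<^sup>2 \<partial>M) \<le> (\<Sum>e\<in>F. (?R \<bullet> e)\<^sup>2 + ?C e \<bullet> e)"
      using e by (intro sum_mono) blast
    also have "\<dots> = (\<Sum>e\<in>F. (?R \<bullet> e)\<^sup>2) + \<gamma>\<^sup>2 / \<alpha> * (\<Sum>e\<in>F. S e \<bullet> e)"
      by (simp add: sum.distrib sum_distrib_left)
    also have "\<dots> \<le> (norm ?R)\<^sup>2 + \<gamma>\<^sup>2 / \<alpha> * op_trace S"
      using F ga by (intro add_mono mult_left_mono trace_bound Bessel_inequality[OF orthonormal_basis_imp_orthonormal[OF B]])
        (auto simp: B_def)
    finally show ?thesis using bias by simp
  qed
  have "0 \<le> b" using bias by (rule order_trans[OF zero_le_power2])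
  moreover have "0 \<le> op_trace S" using trace_bound[of "{}"] by simp
  ultimately have "0 \<le> b + \<gamma>\<^sup>2 / \<alpha> * op_trace S"
    using ga by (intro add_nonneg_nonneg mult_nonneg_nonneg)
  from mean_square_le_coordinates[OF Zm B countable_orthonormal_basis[OF B] this _ fin] e
  show ?thesis by blast
qed

theorem theorem1:
  fixes A :: "'x::{real_inner,banach} \<Rightarrow> 'y::{real_inner,banach}"
    and S\<^sub>0 :: "'x \<Rightarrow> 'x" and u m\<^sub>0 :: 'x and a c s :: real
  assumes "compact_operator A"
    and "assumption_A A S\<^sub>0 u m\<^sub>0 a c s"
  shows "\<exists>C::real. \<forall>\<gamma>>0. \<forall>(M::'w measure) y. data_model_1 M A u \<gamma> y \<longrightarrow>
     (\<forall>\<alpha>>0. \<forall>m. kalman_mean M A \<gamma> (\<lambda>x. (\<gamma>\<^sup>2 / \<alpha>) *\<^sub>R S\<^sub>0 x) m\<^sub>0 y m \<longrightarrow>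
        (\<forall>n\<ge>1. mean_square_le M (\<lambda>\<omega>. m n \<omega> - u)
           (C * (\<alpha> / real n) powr (s / (a + 1)) + \<gamma>\<^sup>2 / \<alpha> * op_trace S\<^sub>0))) \<and>
     (\<forall>N\<ge>1. \<forall>\<alpha> m. \<alpha> = real N powr (s / (s + a + 1)) \<longrightarrow>
        kalman_mean M A \<gamma> (\<lambda>x. (\<gamma>\<^sup>2 / \<alpha>) *\<^sub>R S\<^sub>0 x) m\<^sub>0 y m \<longrightarrow>
        mean_square_le M (\<lambda>\<omega>. m N \<omega> - u)
          ((C + \<gamma>\<^sup>2 * op_trace S\<^sub>0) * real N powr (- s / (s + a + 1))))"
proof -
  have A: "bounded_linear A" using assms(1) by (simp add: compact_operator_def)
  have tc: "positive_trace_class S\<^sub>0" and inj: "inj S\<^sub>0" and a: "0 < a" and c: "1 \<le> c"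
    and Abd: "\<And>x. inverse c * norm (op_powr S\<^sub>0 (a / 2) x) \<le> norm (A x)"
      "\<And>x. norm (A x) \<le> c * norm (op_powr S\<^sub>0 (a / 2) x)"
    and s: "0 \<le> s" "s \<le> a + 2" and v: "m\<^sub>0 - u \<in> op_powr_domain S\<^sub>0 (- s / 2)"
    using assms(2) unfolding assumption_A_def by blast+
  interpret smoothing_operator S\<^sub>0 A a c
    using tc inj A a c Abd
    by (simp add: smoothing_operator_def smoothing_operator_axioms_def injective_trace_class_def)
  define W where "W = (\<Sum>\<^sub>\<infinity>e\<in>E. lam e powr (- s) * ((m\<^sub>0 - u) \<bullet> e)\<^sup>2)"
  have W: "((\<lambda>e. lam e powr (- s) * ((m\<^sub>0 - u) \<bullet> e)\<^sup>2) has_sum W) E"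
    using op_powr_domain_summable[OF v] by (simp add: W_def)
  \<comment> \<open>\<open>W\<close> is the squared norm of \<open>m\<^sub>0 - u\<close> in the
    source condition; it is fixed before the noise level, \<alpha>, the probability space and
    \<open>n\<close> are introduced, and so is \<open>C\<close>.\<close>
  define C where "C = 10 * c ^ 4 * W"
  have general: "mean_square_le M (\<lambda>\<omega>. m n \<omega> - u)
      (C * (\<alpha> / real n) powr (s / (a + 1)) + \<gamma>\<^sup>2 / \<alpha> * op_trace S\<^sub>0)"
    if \<gamma>: "0 < \<gamma>" and y: "data_model_1 M A u \<gamma> y" and \<alpha>: "0 < \<alpha>"
      and m: "kalman_mean M A \<gamma> (\<lambda>x. (\<gamma>\<^sup>2 / \<alpha>) *\<^sub>R S\<^sub>0 x) m\<^sub>0 y m" and n: "1 \<le> n"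
    for \<gamma> \<alpha> m n y and M :: "'w measure"
  proof (rule kalman_mean_square_error[OF A \<gamma> \<alpha> y m])
    let ?R = "kalman_error_map A \<gamma> (\<lambda>x. (\<gamma>\<^sup>2 / \<alpha>) *\<^sub>R S\<^sub>0 x) n"
    have "positive_selfadjoint (\<lambda>x. (\<gamma>\<^sup>2 / \<alpha>) *\<^sub>R S\<^sub>0 x)"
      using psa \<alpha> by (intro positive_selfadjoint_scaleR) auto
    then have R: "bounded_linear ?R" by (rule bounded_linear_kalman_error_map[OF A \<gamma>])
    have "(\<alpha> / real n) *\<^sub>R ?R v + S\<^sub>0 (adjoint A (A (?R v))) = (\<alpha> / real n) *\<^sub>R v" for v
    proof -
      have "(1 / real n) *\<^sub>R (\<alpha> *\<^sub>R ?R v + real n *\<^sub>R S\<^sub>0 (adjoint A (A (?R v)))) = (1 / real n) *\<^sub>R (\<alpha> *\<^sub>R v)"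
        by (simp only: kalman_error_map_equation[OF A \<gamma> \<alpha> psa])
      then show ?thesis using n by (simp add: scaleR_right_distrib)
    qed
    from bias_bound[OF _ s R this W] \<alpha> n
    show "(norm (?R (m\<^sub>0 - u)))\<^sup>2 \<le> C * (\<alpha> / real n) powr (s / (a + 1))"
      by (simp add: C_def)
  qed
  have special: "mean_square_le M (\<lambda>\<omega>. m N \<omega> - u)
      ((C + \<gamma>\<^sup>2 * op_trace S\<^sub>0) * real N powr (- s / (s + a + 1)))"
    if \<gamma>: "0 < \<gamma>" and y: "data_model_1 M A u \<gamma> y" and \<alpha>: "\<alpha> = real N powr (s / (s + a + 1))"
      and m: "kalman_mean M A \<gamma> (\<lambda>x. (\<gamma>\<^sup>2 / \<alpha>) *\<^sub>R S\<^sub>0 x) m\<^sub>0 y m" and N: "1 \<le> N"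
    for \<gamma> \<alpha> m N y and M :: "'w measure"
  proof -
    \<comment> \<open>The exponent of \<alpha> makes
      \<open>(\<alpha> / N) powr (s / (a + 1))\<close> and \<open>1 / \<alpha>\<close> the same
      power of \<open>N\<close>, so bias and variance decay at one rate.\<close>
    have sa: "0 < s + a + 1" using s a by simp
    have "\<alpha> / real N = real N powr (s / (s + a + 1) - 1)" using N by (simp add: \<alpha> powr_diff)
    also have "s / (s + a + 1) - 1 = - (a + 1) / (s + a + 1)" using sa by (simp add: field_simps)
    finally have "(\<alpha> / real N) powr (s / (a + 1)) = real N powr (- (a + 1) / (s + a + 1) * (s / (a + 1)))"
      by (simp add: powr_powr)
    also have "- (a + 1) / (s + a + 1) * (s / (a + 1)) = - s / (s + a + 1)"
    proof -
      have "- k / r * (s / k) = - s / r" if "k \<noteq> 0" for k r :: real using that by simp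
      from this[of "a + 1" "s + a + 1"] show ?thesis using a by linarith
    qed
    finally have 1: "(\<alpha> / real N) powr (s / (a + 1)) = real N powr (- s / (s + a + 1))" .
    have 2: "\<gamma>\<^sup>2 / \<alpha> = \<gamma>\<^sup>2 * real N powr (- s / (s + a + 1))"
      by (simp add: \<alpha> powr_minus divide_inverse)
    have "0 < \<alpha>" using N by (simp add: \<alpha>)
    from general[OF \<gamma> y this m N] show ?thesis unfolding 1 2 by (simp add: algebra_simps)
  qed
  from general special show ?thesis by blast
qed

end
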